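(* Let $\beta>1$. There exist $n\ge1$ and $\pi\in\mathcal{S}_n$ with $B_-(\pi)=\beta$ if and only if $\beta$ is an Yrrap number.
   Context: For an ordered set $X$, $f:X\to X$ and $x$ with $f^0(x),\dots,f^{n-1}(x)$ distinct, $\mathrm{Pat}(x,f,n)=\pi\in\mathcal{S}_n$ means $\pi(i)<\pi(j)$ exactly when $f^{i-1}(x)<f^{j-1}(x)$; $\mathcal{A}(f)$ is the set of all such patterns (all $x$, $n$). For $\beta>1$, $T_{-\beta}:(0,1]\to(0,1]$, $x\mapsto\lfloor\beta x\rfloor+1-\beta x$, and $B_-(\pi)=\inf\{\beta>1:\pi\in\mathcal{A}(T_{-\beta})\}$. The $(-\beta)$-expansion of $x\in(0,1]$ is $d_{-\beta}(x)=d_{-\beta,1}(x)d_{-\beta,2}(x)\cdots$ with $d_{-\beta,k}(x)=\lfloor\beta T_{-\beta}^{k-1}(x)\rfloor$. A number $\beta>1$ is an Yrrap number if $d_{-\beta}(1)$ is eventually periodic. *)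

theory Defs
  imports Complex_Main "HOL-Combinatorics.Permutations"
begin

text \<open>The value \<open>f\<^sup>k(x)\<close> is \<open>(f ^^ k) x\<close>. A permutation in \<open>S\<^sub>n\<close> is a function
  \<open>\<pi>\<close> with \<open>\<pi> permutes {1..n}\<close>.\<close>

definition is_Pat :: "'a::linorder \<Rightarrow> ('a \<Rightarrow> 'a) \<Rightarrow> nat \<Rightarrow> (nat \<Rightarrow> nat) \<Rightarrow> bool" where
  "is_Pat x f n \<pi> \<longleftrightarrow>
     inj_on (\<lambda>k. (f ^^ k) x) {0..<n} \<and>
     \<pi> permutes {1..n} \<and>
     (\<forall>i\<in>{1..n}. \<forall>j\<in>{1..n}. \<pi> i < \<pi> j \<longleftrightarrow> (f ^^ (i - 1)) x < (f ^^ (j - 1)) x)"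

text \<open>A pattern carries its length \<open>n\<close> explicitly, since a function permuting \<open>{1..n}\<close> also
  permutes every larger \<open>{1..m}\<close>. The set \<open>X\<close> is the domain of the map; it is meant to be
  invariant under \<open>f\<close>.\<close>

definition allowed_patterns :: "'a::linorder set \<Rightarrow> ('a \<Rightarrow> 'a) \<Rightarrow> (nat \<times> (nat \<Rightarrow> nat)) set" where
  "allowed_patterns X f = {(n, \<pi>). n \<ge> 1 \<and> (\<exists>x\<in>X. is_Pat x f n \<pi>)}"

definition neg_beta :: "real \<Rightarrow> real \<Rightarrow> real" where
  "neg_beta \<beta> x = of_int \<lfloor>\<beta> * x\<rfloor> + 1 - \<beta> * x"

lemma neg_beta_in_unit: "neg_beta \<beta> x \<in> {0<..1}"
  unfolding neg_beta_def greaterThanAtMost_iff by linarith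

text \<open>The set below is bounded below by \<open>1\<close>, and it is nonempty for every \<open>\<pi>\<close> in \<open>S\<^sub>n\<close>,
  \<open>n \<ge> 1\<close>: if \<open>\<beta>\<close> is a large integer, some point has an expansion whose first \<open>n\<close> digits are
  \<open>\<pi>(1), \<dots>, \<pi>(n)\<close>. So the infimum is a genuine one.\<close>

definition B_minus :: "nat \<Rightarrow> (nat \<Rightarrow> nat) \<Rightarrow> real" where
  "B_minus n \<pi> = Inf {\<beta>. \<beta> > 1 \<and> (n, \<pi>) \<in> allowed_patterns {0<..1} (neg_beta \<beta>)}"

text \<open>Digits are indexed from \<open>k = 1\<close>; the value at \<open>k = 0\<close> is irrelevant.\<close>

definition neg_digit :: "real \<Rightarrow> real \<Rightarrow> nat \<Rightarrow> int" where
  "neg_digit \<beta> x k = \<lfloor>\<beta> * (neg_beta \<beta> ^^ (k - 1)) x\<rfloor>"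

definition eventually_periodic :: "(nat \<Rightarrow> 'a) \<Rightarrow> bool" where
  "eventually_periodic s \<longleftrightarrow> (\<exists>m p. p \<ge> 1 \<and> (\<forall>k>m. s (k + p) = s k))"

definition Yrrap :: "real \<Rightarrow> bool" where
  "Yrrap \<beta> \<longleftrightarrow> \<beta> > 1 \<and> eventually_periodic (neg_digit \<beta> 1)"

end

theory Submission
  imports Defs "HOL-Library.Infinite_Set"
begin

text \<open>
  If \<open>B_minus n \<pi> = \<beta>\<close>, then realizations of \<open>\<pi>\<close> in bases decreasing to \<open>\<beta>\<close> converge to an orbit in
  base \<open>\<beta>\<close> that satisfies all order constraints weakly. For an infinite orbit of \<open>1\<close>, the tight
  constraints reduce to a single one, so they can all be made strict by moving the starting point;
  then \<open>\<pi>\<close> also occurs in bases below \<open>\<beta>\<close>.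

  Conversely, let the orbit of \<open>1\<close> be finite. In base \<open>b\<close>, the formal eventually periodic orbit with
  the digits of the \<open>\<beta>\<close>-expansion of \<open>1\<close> starts at some \<open>\<zeta> b\<close>, and as long as its points are ordered as in
  base \<open>\<beta>\<close>, comparing distances shows \<open>\<zeta> b \<le> 1\<close> only for \<open>b \<ge> \<beta>\<close>. For \<open>b\<close> slightly above \<open>\<beta>\<close> we realize a
  pattern whose first points increase, which determines all digits, and which visits a point
  below \<open>\<zeta> b\<close> and a point above \<open>\<zeta> b\<close>. The pattern enforces these relations, and hence the order of the
  formal orbit, in every base, so it does not occur below \<open>\<beta>\<close>. For an integer \<open>\<beta>\<close> the identity on
  \<open>\<beta> + 2\<close> points works.
\<close>

section \<open>Orbits with prescribed digits\<close>

abbreviation iter :: "real \<Rightarrow> nat \<Rightarrow> real \<Rightarrow> real" where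
  "iter b k x \<equiv> (neg_beta b ^^ k) x"

fun orb :: "(nat \<Rightarrow> int) \<Rightarrow> real \<Rightarrow> real \<Rightarrow> nat \<Rightarrow> real" where
  "orb d b x 0 = x"
| "orb d b x (Suc k) = of_int (d k) + 1 - b * orb d b x k"

text \<open>The digits are shared and cancel in a difference, so each step multiplies it by
  \<open>- b\<close>. Hence every point of a formal orbit is an affine function of its starting
  point.\<close>

lemma orb_diff: "orb d b x k - orb d b y k = (- b) ^ k * (x - y)"
proof (induction k)
  case (Suc k)
  have "orb d b x (Suc k) - orb d b y (Suc k) = - b * (orb d b x k - orb d b y k)"
    by (simp add: algebra_simps)
  then show ?case
    using Suc by simp
qed simp

lemma orb_add: "orb d b x (i + k) = orb (\<lambda>j. d (i + j)) b (orb d b x i) k"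
  by (induction k) auto

lemma orb_cong: "(\<And>j. j < k \<Longrightarrow> d j = e j) \<Longrightarrow> orb d b x k = orb e b x k"
  by (induction k) auto

lemma tendsto_orb:
  assumes "(f \<longlongrightarrow> b) F" "(g \<longlongrightarrow> x) F"
  shows "((\<lambda>t. orb d (f t) (g t) k) \<longlongrightarrow> orb d b x k) F"
  using assms by (induction k) (auto intro!: tendsto_intros)

lemma iter_eq_orb: "iter b k x = orb (\<lambda>j. \<lfloor>b * iter b j x\<rfloor>) b x k"
  by (induction k) (auto simp: neg_beta_def)

lemma iter_in_unit: "x \<in> {0<..1} \<Longrightarrow> iter b k x \<in> {0<..1}"
  using neg_beta_in_unit by (cases k) auto

lemma neg_beta_eqI: "0 < of_int e + 1 - b * y \<Longrightarrow> of_int e + 1 - b * y \<le> 1 \<Longrightarrow>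
  \<lfloor>b * y\<rfloor> = e \<and> neg_beta b y = of_int e + 1 - b * (y::real)"
proof -
  assume "0 < of_int e + 1 - b * y" "of_int e + 1 - b * y \<le> 1"
  then have "\<lfloor>b * y\<rfloor> = e" by linarith
  then show ?thesis by (simp add: neg_beta_def)
qed

text \<open>The interval \<open>(0, 1]\<close> contains \<open>of_int e + 1 - b * y\<close> for only
  one integer \<open>e\<close>, so an orbit that stays in it has the prescribed digits as its true
  digits.\<close>

lemma orb_eq_iter:
  assumes "\<And>k. k < n \<Longrightarrow> 0 < orb d b x k \<and> orb d b x k \<le> 1" "k < n"
  shows "orb d b x k = iter b k x"
  using assms(2)
proof (induction k)
  case (Suc k)
  then have "0 < orb d b x (Suc k)" "orb d b x (Suc k) \<le> 1"
    using assms(1) by blast+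
  then show ?case
    using Suc neg_beta_eqI[of "d k" b "orb d b x k"] by simp
qed simp

lemma orb_digit:
  assumes "0 < orb d b x (Suc k)" "orb d b x (Suc k) \<le> 1"
  shows "\<lfloor>b * orb d b x k\<rfloor> = d k"
  using assms neg_beta_eqI[of "d k" b "orb d b x k"] by simp

lemma iter_add: "iter b (i + k) x = iter b k (iter b i x)"
  by (simp add: add.commute[of i] funpow_add)

text \<open>The higher power dominates in absolute value, so the difference has the sign of
  \<open>(- b) ^ k\<close>.\<close>

lemma pow_diff_sign:
  fixes b :: real
  assumes "b > 1" "m < k"
  shows "0 < (- 1) ^ k * ((- b) ^ k - (- b) ^ m)"
proof -
  have "b ^ m < b ^ k"
    using assms by simp
  moreover have "(- 1) ^ k * (- b) ^ k = b ^ k"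
    by (simp flip: power_mult_distrib)
  moreover have "(- 1) ^ k * (- b) ^ m \<le> b ^ m"
  proof -
    have "\<bar>(- 1) ^ k * (- b) ^ m\<bar> = b ^ m"
      using assms by (simp add: abs_mult power_abs)
    then show ?thesis by linarith
  qed
  ultimately show ?thesis
    by (simp add: right_diff_distrib)
qed

lemma pow_diff_ne:
  fixes b :: real
  assumes "b > 1" "m \<noteq> k"
  shows "(- b) ^ k - (- b) ^ m \<noteq> 0"
  using assms pow_diff_sign[of b m k] pow_diff_sign[of b k m]
  by (cases "m < k") (auto simp: not_less)

text \<open>The starting point from which \<open>orb d b\<close> returns at time \<open>K\<close> to its position at time \<open>m\<close>.\<close>

definition periodic_start :: "(nat \<Rightarrow> int) \<Rightarrow> nat \<Rightarrow> nat \<Rightarrow> real \<Rightarrow> real" where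
  "periodic_start d m K b = - (orb d b 0 K - orb d b 0 m) / ((- b) ^ K - (- b) ^ m)"

text \<open>The displacement between the times \<open>m\<close> and \<open>K\<close> is affine in
  \<open>x\<close> and vanishes at \<open>periodic_start\<close>. Its sign therefore tells on which
  side of that point \<open>x\<close> lies.\<close>

lemma orb_return_diff:
  assumes "b > 1" "m < K"
  shows "orb d b x K - orb d b x m = ((- b) ^ K - (- b) ^ m) * (x - periodic_start d m K b)"
proof -
  have "orb d b x K = orb d b 0 K + (- b) ^ K * x" "orb d b x m = orb d b 0 m + (- b) ^ m * x"
    using orb_diff[of d b x _ 0] by (simp_all add: algebra_simps)
  moreover have "((- b) ^ K - (- b) ^ m) * periodic_start d m K b = - (orb d b 0 K - orb d b 0 m)"
    using pow_diff_ne[of b m K] assms by (simp add: periodic_start_def)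
  ultimately show ?thesis by (simp add: algebra_simps)
qed

lemma orb_periodic_start:
  assumes "b > 1" "m < K"
  shows "orb d b (periodic_start d m K b) K = orb d b (periodic_start d m K b) m"
  using orb_return_diff[OF assms, of d "periodic_start d m K b"] by simp

lemma periodic_start_eqI:
  assumes "b > 1" "m < K" "orb d b x K = orb d b x m"
  shows "periodic_start d m K b = x"
  using orb_return_diff[OF assms(1,2), of d x] assms pow_diff_ne[of b m K] by simp

lemma tendsto_periodic_start:
  assumes "b > 1" "m < K" "(f \<longlongrightarrow> b) F"
  shows "((\<lambda>t. periodic_start d m K (f t)) \<longlongrightarrow> periodic_start d m K b) F"
  unfolding periodic_start_def
  using assms pow_diff_ne[of b m K] by (intro tendsto_intros tendsto_orb) auto

text \<open>Every index reduces to one below \<open>K\<close> by replacing \<open>K\<close> with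
  \<open>m\<close>. Both \<open>y\<close> and the orbit of \<open>x\<close> permit this replacement,
  and below \<open>K\<close> equal values of \<open>y\<close> mean equal indices.\<close>

lemma orb_collapse:
  assumes det: "\<And>j k. y j = y k \<Longrightarrow> y (Suc j) = y (Suc k) \<and> d j = d k"
    and K: "m < K" "y K = y m" "inj_on y {..<K}"
    and Z: "orb d b x K = orb d b x m"
    and "y i = y j"
  shows "orb d b x i = orb d b x j"
proof -
  have red: "\<exists>l'<K. y l = y l' \<and> orb d b x l = orb d b x l'" for l
  proof (induction l)
    case 0
    then show ?case using K by (intro exI[of _ 0]) auto
  next
    case (Suc l)
    then obtain l' where l': "l' < K" "y l = y l'" "orb d b x l = orb d b x l'" by blast
    then have *: "y (Suc l) = y (Suc l')" "orb d b x (Suc l) = orb d b x (Suc l')"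
      using det[of l l'] by auto
    show ?case
    proof (cases "Suc l' < K")
      case True
      then show ?thesis using * by blast
    next
      case False
      then have "Suc l' = K" using l' by simp
      then show ?thesis using * K Z by metis
    qed
  qed
  obtain i' j' where "i' < K" "y i = y i'" "orb d b x i = orb d b x i'"
    "j' < K" "y j = y j'" "orb d b x j = orb d b x j'"
    using red by meson
  then show ?thesis
    using \<open>y i = y j\<close> K(3) by (metis inj_onD lessThan_iff)
qed

text \<open>Rescaling: the smallest ratio between corresponding distances in the two systems (with the
  point 0 added) cannot shrink under the expanding map, which forces \<open>b \<le> b'\<close>.\<close>

lemma expansion_le:
  fixes c z :: "nat \<Rightarrow> real" and a :: "nat \<Rightarrow> int"
  assumes K: "0 < K" and f: "\<And>k. k < K \<Longrightarrow> f k < K"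
    and c: "\<And>k. k < K \<Longrightarrow> b * c k = a k + 1 - c (f k)"
    and z: "\<And>k. k < K \<Longrightarrow> b' * z k = a k + 1 - z (f k)"
    and pos: "\<And>k. k < K \<Longrightarrow> 0 < c k" "\<And>k. k < K \<Longrightarrow> 0 < z k"
    and ord: "\<And>j k. j < K \<Longrightarrow> k < K \<Longrightarrow> c j < c k \<longleftrightarrow> z j < z k"
    and top: "\<And>k. k < K \<Longrightarrow> c k \<le> c 0"
    and a: "\<And>k. k < K \<Longrightarrow> 0 \<le> a k"
      "\<And>j k. j < K \<Longrightarrow> k < K \<Longrightarrow> c j < c k \<Longrightarrow> a j \<le> a k"
      "\<And>j k. j < K \<Longrightarrow> k < K \<Longrightarrow> c j < c k \<Longrightarrow> c (f j) < c (f k) \<Longrightarrow> a j < a k"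
    and scale: "z 0 \<le> 1" "1 \<le> c 0"
  shows "b \<le> b'"
proof -
  \<comment> \<open>The quotients \<open>z k / c k\<close> are the ratios of the distances to the
    added point 0.\<close>
  define R where "R = (\<lambda>k. z k / c k) ` {..<K} \<union>
    (\<lambda>(j, k). (z k - z j) / (c k - c j)) ` {(j, k). j < K \<and> k < K \<and> c j < c k}"
  have "{(j, k). j < K \<and> k < K \<and> c j < c k} \<subseteq> {..<K} \<times> {..<K}"
    by auto
  then have fin: "finite R"
    unfolding R_def by (meson finite_SigmaI finite_UnI finite_imageI finite_lessThan finite_subset)
  have ne: "R \<noteq> {}" using K by (auto simp: R_def)
  define t where "t = Min R"
  have tR: "t \<in> R" and tmin: "\<And>r. r \<in> R \<Longrightarrow> t \<le> r"
    using fin ne by (auto simp: t_def)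
  have t1: "t * c k \<le> z k" if "k < K" for k
  proof -
    have "z k / c k \<in> R" using that by (auto simp: R_def)
    then have "t \<le> z k / c k" by (rule tmin)
    then show ?thesis using pos(1)[OF that] by (simp add: pos_le_divide_eq)
  qed
  have t2: "t * (c k - c j) \<le> z k - z j" if "k < K" "j < K" "c j \<le> c k" for j k
  proof (cases "c j = c k")
    case True
    then have "z j = z k" using ord[of j k] ord[of k j] that by simp
    then show ?thesis using True by simp
  next
    case False
    then have less: "c j < c k" using that by simp
    then have "(z k - z j) / (c k - c j) \<in> R"
      unfolding R_def using that by (intro UnI2 image_eqI[of _ _ "(j, k)"]) auto
    then have "t \<le> (z k - z j) / (c k - c j)" by (rule tmin)
    then show ?thesis using less by (simp add: pos_le_divide_eq)
  qed
  from tR have cases_t: "(\<exists>k<K. t = z k / c k) \<or>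
      (\<exists>j k. j < K \<and> k < K \<and> c j < c k \<and> t = (z k - z j) / (c k - c j))"
    unfolding R_def by auto
  then consider (one) k where "k < K" "t = z k / c k"
    | (two) j k where "j < K" "k < K" "c j < c k" "t = (z k - z j) / (c k - c j)"
    by blast
  note cases_t = this
  have t0: "t \<ge> 0"
    using cases_t
  proof cases
    case one
    then show ?thesis using pos[of k] by simp
  next
    case two
    then show ?thesis using ord[of j k] by simp
  qed
  have tle: "t \<le> 1"
  proof -
    have "t * 1 \<le> t * c 0" using t0 scale by (intro mult_left_mono)
    then show ?thesis using t1[OF K] scale by simp
  qed
  \<comment> \<open>The point 1 may be added on top as well: replacing the top points by 1 shortens
    the distances in \<open>c\<close> and lengthens those in \<open>z\<close>.\<close>
  have up: "t * (1 - c k) \<le> 1 - z k" if "k < K" for k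
  proof -
    have "t * (c 0 - c k) \<le> z 0 - z k" using t2[of 0 k] that K top by simp
    moreover have "t * 1 \<le> t * c 0" using t0 scale by (intro mult_left_mono)
    ultimately show ?thesis using scale by (simp add: right_diff_distrib)
  qed
  have at: "t * of_int r \<le> of_int r" if "0 \<le> r" for r
    using tle that by (simp add: mult_left_le_one_le t0)
  \<comment> \<open>The map is applied to both ends of a minimizing pair, which scales the distances
    by \<open>b\<close> and \<open>b'\<close>. The image distance is cut into whole units,
    controlled by \<open>at\<close>, and distances between points including 0 and 1, controlled by
    \<open>t1\<close>, \<open>t2\<close> and \<open>up\<close>.\<close>
  from cases_t show ?thesis
  proof cases
    case one
    have "b * z k = t * (b * c k)" using one pos(1)[of k] by simp
    also have "\<dots> = t * of_int (a k) + t * (1 - c (f k))"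
      unfolding c[OF one(1)] by (simp add: algebra_simps)
    also have "\<dots> \<le> a k + (1 - z (f k))" using at[OF a(1)[OF one(1)]] up[OF f[OF one(1)]] by linarith
    also have "\<dots> = b' * z k" using z[OF one(1)] by simp
    finally show ?thesis using pos(2)[of k] one by simp
  next
    case two
    have zz: "0 < z k - z j" using ord two by simp
    have "z k - z j = t * (c k - c j)" using two by simp
    then have "b * (z k - z j) = t * (b * c k - b * c j)" by (simp add: right_diff_distrib)
    also have "\<dots> = t * of_int (a k - a j) + t * (c (f j) - c (f k))"
      unfolding c[OF two(1)] c[OF two(2)] by (simp add: algebra_simps)
    also have "\<dots> \<le> of_int (a k - a j) + (z (f j) - z (f k))"
    proof (cases "c (f k) \<le> c (f j)")
      case True
      have "0 \<le> a k - a j" using a(2)[OF two(1-3)] by simp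
      then show ?thesis using at[of "a k - a j"] t2[OF f[OF two(1)] f[OF two(2)] True] by linarith
    next
      case False
      \<comment> \<open>The images keep the order, so the digits differ by at least 1. One unit is
        used up in writing the remaining distance as the sum of \<open>c (f j)\<close> and
        \<open>1 - c (f k)\<close>.\<close>
      have "0 \<le> a k - a j - 1" using a(3)[OF two(1-3)] False by simp
      then have "t * of_int (a k - a j - 1) + t * c (f j) + t * (1 - c (f k))
        \<le> of_int (a k - a j - 1) + z (f j) + (1 - z (f k))"
        using at[of "a k - a j - 1"] t1[OF f[OF two(1)]] up[OF f[OF two(2)]] by linarith
      then show ?thesis by (simp add: algebra_simps)
    qed
    also have "\<dots> = b' * (z k - z j)" using z[OF two(1)] z[OF two(2)] by (simp add: algebra_simps)
    finally show ?thesis using zz by simp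
  qed
qed

section \<open>Patterns and the digits they determine\<close>

lemma is_Pat_less_iff:
  assumes "is_Pat x f n \<pi>" "i < n" "j < n"
  shows "(f ^^ i) x < (f ^^ j) x \<longleftrightarrow> \<pi> (Suc i) < \<pi> (Suc j)"
  using assms unfolding is_Pat_def by (auto dest!: bspec[of _ _ "Suc i"] bspec[of _ _ "Suc j"])

lemma is_PatI:
  assumes perm: "\<pi> permutes {1..n}"
    and less: "\<And>i j. i < n \<Longrightarrow> j < n \<Longrightarrow> \<pi> (Suc i) < \<pi> (Suc j) \<Longrightarrow> (f ^^ i) x < (f ^^ j) x"
  shows "is_Pat x f n \<pi>"
proof -
  have inj: "\<pi> (Suc i) \<noteq> \<pi> (Suc j)" if "i \<noteq> j" for i j
    using permutes_inj[OF perm] that by (auto dest: injD)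
  have iff: "(f ^^ i) x < (f ^^ j) x \<longleftrightarrow> \<pi> (Suc i) < \<pi> (Suc j)" if "i < n" "j < n" for i j
    using less[of i j] less[of j i] inj[of i j] that
    by (metis linorder_neqE_nat order_less_asym order_less_irrefl)
  show ?thesis
    unfolding is_Pat_def
  proof (intro conjI perm inj_onI ballI)
    fix i j assume "i \<in> {0..<n}" "j \<in> {0..<n}" "(f ^^ i) x = (f ^^ j) x"
    then show "i = j"
      using iff[of i j] iff[of j i] inj[of i j] by force
  next
    fix i j assume "i \<in> {1..n}" "j \<in> {1..n}"
    then show "\<pi> i < \<pi> j \<longleftrightarrow> (f ^^ (i - 1)) x < (f ^^ (j - 1)) x"
      using iff[of "i - 1" "j - 1"] by (cases i; cases j) auto
  qed
qed

lemma ex_is_Pat: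
  fixes f :: "'a::linorder \<Rightarrow> 'a"
  assumes inj: "inj_on (\<lambda>k. (f ^^ k) x) {..<n}"
  shows "\<exists>\<pi>. is_Pat x f n \<pi>"
proof -
  define y where "y i = (f ^^ (i - 1)) x" for i
  \<comment> \<open>The rank of the point within the orbit segment, extended by the identity as
    \<open>permutes\<close> requires.\<close>
  define \<pi> where "\<pi> i = (if i \<in> {1..n} then card {j \<in> {1..n}. y j \<le> y i} else i)" for i
  have y_inj: "inj_on y {1..n}"
  proof (rule inj_onI)
    fix i j assume "i \<in> {1..n}" "j \<in> {1..n}" "y i = y j"
    then show "i = j"
      using inj_onD[OF inj, of "i - 1" "j - 1"] by (cases i; cases j) (auto simp: y_def)
  qed
  have mono: "\<pi> i < \<pi> j" if "i \<in> {1..n}" "j \<in> {1..n}" "y i < y j" for i j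
  proof -
    have "{k \<in> {1..n}. y k \<le> y i} \<subset> {k \<in> {1..n}. y k \<le> y j}"
    proof
      show "{k \<in> {1..n}. y k \<le> y i} \<subseteq> {k \<in> {1..n}. y k \<le> y j}"
        using that(3) by (auto intro: order.trans)
      have "j \<in> {k \<in> {1..n}. y k \<le> y j}" "j \<notin> {k \<in> {1..n}. y k \<le> y i}"
        using that by auto
      then show "{k \<in> {1..n}. y k \<le> y i} \<noteq> {k \<in> {1..n}. y k \<le> y j}" by blast
    qed
    then have "card {k \<in> {1..n}. y k \<le> y i} < card {k \<in> {1..n}. y k \<le> y j}"
      by (intro psubset_card_mono) auto
    then show ?thesis
      using that by (simp add: \<pi>_def)
  qed
  have "inj_on \<pi> {1..n}"
  proof (rule inj_onI)
    fix i j assume "i \<in> {1..n}" "j \<in> {1..n}" "\<pi> i = \<pi> j"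
    then show "i = j"
      using mono[of i j] mono[of j i] inj_onD[OF y_inj, of i j] by force
  qed
  moreover have "\<pi> ` {1..n} \<subseteq> {1..n}"
  proof safe
    fix i assume i: "i \<in> {1..n}"
    have "card {j \<in> {1..n}. y j \<le> y i} \<le> card {1..n}"
      by (intro card_mono) auto
    moreover have "card {j \<in> {1..n}. y j \<le> y i} > 0"
      using i by (auto simp: card_gt_0_iff)
    ultimately show "\<pi> i \<in> {1..n}"
      using i by (simp add: \<pi>_def Suc_le_eq)
  qed
  ultimately have "bij_betw \<pi> {1..n} {1..n}"
    by (simp add: bij_betw_def endo_inj_surj)
  then have perm: "\<pi> permutes {1..n}"
    by (intro bij_imp_permutes) (auto simp: \<pi>_def)
  have "is_Pat x f n \<pi>"
  proof (rule is_PatI[OF perm])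
    fix i j assume ij: "i < n" "j < n" "\<pi> (Suc i) < \<pi> (Suc j)"
    then have "\<not> y (Suc j) < y (Suc i)"
      using mono[of "Suc j" "Suc i"] by auto
    moreover have "y (Suc i) \<noteq> y (Suc j)"
      using ij by (auto simp: \<pi>_def)
    ultimately show "(f ^^ i) x < (f ^^ j) x"
      by (simp add: y_def)
  qed
  then show ?thesis by blast
qed

text \<open>Going backwards from \<open>t\<close>, each inverse branch sends \<open>y\<close> to
  \<open>(of_int e + 1 - y) / b\<close>. For a digit \<open>e\<close> between 0 and
  \<open>b - 1\<close> it maps the open unit interval into itself.\<close>

lemma ex_orb_endpoint:
  assumes "0 < b" "0 < t" "t < 1" and d: "\<And>k. k < n \<Longrightarrow> 0 \<le> d k \<and> of_int (d k) + 1 \<le> b"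
  shows "\<exists>x. orb d b x n = t \<and> (\<forall>k\<le>n. 0 < orb d b x k \<and> orb d b x k < 1)"
proof -
  define x where "x = (t - orb d b 0 n) / (- b) ^ n"
  have end_eq: "orb d b x n = t"
    using orb_diff[of d b x n 0] assms(1) by (simp add: x_def)
  have "0 < orb d b x k \<and> orb d b x k < 1" if "k \<le> n" for k
    using that
  proof (induction rule: inc_induct)
    case base
    then show ?case using end_eq assms by simp
  next
    case (step k)
    then have "b * orb d b x k = of_int (d k) + 1 - orb d b x (Suc k)" by simp
    then have "0 < b * orb d b x k" "b * orb d b x k < b * 1"
      using step d[of k] by linarith+
    then show ?case
      using \<open>0 < b\<close> by (metis mult_less_cancel_left_pos zero_less_mult_pos)
  qed
  then show ?thesis using end_eq by blast
qed

text \<open>Where the digit is constant the map decreases strictly, so a pair whose order is not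
  reversed has different digits.\<close>

lemma floor_less_of_neg_beta_le:
  assumes "b > 0" "y < y'" "neg_beta b y \<le> neg_beta b y'"
  shows "\<lfloor>b * y\<rfloor> < \<lfloor>b * y'\<rfloor>"
proof -
  have "b * y < b * y'" using assms by simp
  then have "(of_int \<lfloor>b * y\<rfloor> :: real) < of_int \<lfloor>b * y'\<rfloor>"
    using assms unfolding neg_beta_def by linarith
  then show ?thesis by simp
qed

text \<open>If the first \<open>N + 2\<close> points of an orbit increase, where \<open>N\<close> is the largest digit, then
  their digits are \<open>0, \<dots>, N\<close>, and these points locate the discontinuities well enough for
  the order relations in the orbit to determine all further digits.\<close>

lemma floor_increasing_prefix:
  assumes "b > 0" "x \<in> {0<..1}"
    and inc: "\<And>k. k \<le> N \<Longrightarrow> iter b k x < iter b (Suc k) x"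
    and "k \<le> N"
  shows "int k \<le> \<lfloor>b * iter b k x\<rfloor>"
  using \<open>k \<le> N\<close>
proof (induction k)
  case 0
  then show ?case using assms by simp
next
  case (Suc k)
  have "\<lfloor>b * iter b k x\<rfloor> < \<lfloor>b * iter b (Suc k) x\<rfloor>"
    using inc[of k] inc[of "Suc k"] Suc \<open>b > 0\<close> by (intro floor_less_of_neg_beta_le) auto
  then show ?case using Suc by simp
qed

text \<open>The \<open>N + 1\<close> digits increase strictly within the range from 0 to
  \<open>N\<close>, which leaves no room for a gap.\<close>

lemma floor_increasing_prefix_eq:
  assumes "b > 0" "\<lfloor>b\<rfloor> \<le> int N" "x \<in> {0<..1}"
    and inc: "\<And>k. k \<le> N \<Longrightarrow> iter b k x < iter b (Suc k) x"
    and "k \<le> N"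
  shows "\<lfloor>b * iter b k x\<rfloor> = int k"
proof -
  have "\<lfloor>b * iter b k x\<rfloor> \<le> int k"
    using \<open>k \<le> N\<close>
  proof (induction rule: inc_induct)
    case base
    have "b * iter b N x \<le> b"
      using iter_in_unit[OF assms(3), where k = N and b = b] \<open>b > 0\<close> by simp
    then show ?case using assms(2) by (meson floor_mono order.trans)
  next
    case (step k)
    have "\<lfloor>b * iter b k x\<rfloor> < \<lfloor>b * iter b (Suc k) x\<rfloor>"
      using inc[of k] inc[of "Suc k"] step \<open>b > 0\<close> by (intro floor_less_of_neg_beta_le) auto
    then show ?case using step by simp
  qed
  then show ?thesis
    using floor_increasing_prefix[OF assms(1,3) inc assms(5)] by simp
qed

text \<open>The \<open>k\<close>-th prefix point has digit \<open>k\<close>, so only a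
  \<open>y\<close> strictly between the prefix points \<open>j\<close> and \<open>j + 1\<close> is
  in doubt: its digit is \<open>j\<close> or \<open>j + 1\<close>. As branches decrease, digit
  \<open>j\<close> puts the image of \<open>y\<close> below the prefix point \<open>j + 1\<close>,
  while digit \<open>j + 1\<close> puts it above the prefix point \<open>j + 2\<close>, hence above
  \<open>j + 1\<close>.\<close>

lemma digit_ge_iff:
  fixes b x y :: real
  assumes b: "b > 0" "\<lfloor>b\<rfloor> \<le> int N" "x \<in> {0<..1}"
    and inc: "\<And>k. k \<le> N \<Longrightarrow> iter b k x < iter b (Suc k) x"
    and j: "Suc j \<le> N"
  shows "int (Suc j) \<le> \<lfloor>b * y\<rfloor> \<longleftrightarrow>
    iter b (Suc j) x \<le> y \<or> iter b j x < y \<and> iter b (Suc j) x < neg_beta b y"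
proof -
  have w: "\<lfloor>b * iter b k x\<rfloor> = int k" if "k \<le> N" for k
    by (rule floor_increasing_prefix_eq[OF b _ that]) (rule inc)
  show ?thesis
  proof
    assume L: "int (Suc j) \<le> \<lfloor>b * y\<rfloor>"
    show "iter b (Suc j) x \<le> y \<or> iter b j x < y \<and> iter b (Suc j) x < neg_beta b y"
    proof (cases "iter b (Suc j) x \<le> y")
      case False
      then have "b * y < b * iter b (Suc j) x" using b by simp
      then have "\<lfloor>b * y\<rfloor> \<le> \<lfloor>b * iter b (Suc j) x\<rfloor>" by (intro floor_mono) simp
      then have eq: "\<lfloor>b * y\<rfloor> = int (Suc j)" using w[OF j] L by simp
      have "\<lfloor>b * iter b j x\<rfloor> < \<lfloor>b * y\<rfloor>" using w[of j] j eq by simp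
      then have "b * iter b j x < b * y" by (meson floor_less_cancel)
      then have "iter b j x < y" using b by simp
      moreover have "iter b (Suc (Suc j)) x < neg_beta b y"
        using \<open>b * y < b * iter b (Suc j) x\<close> w[OF j] eq unfolding neg_beta_def funpow.simps o_apply
        by simp
      ultimately show ?thesis using inc[OF j] by (meson order.strict_trans)
    qed simp
  next
    assume "iter b (Suc j) x \<le> y \<or> iter b j x < y \<and> iter b (Suc j) x < neg_beta b y"
    then show "int (Suc j) \<le> \<lfloor>b * y\<rfloor>"
    proof (elim disjE conjE)
      assume "iter b (Suc j) x \<le> y"
      then have "b * iter b (Suc j) x \<le> b * y" using b by simp
      then show ?thesis using w[OF j] floor_mono by metis
    next
      assume "iter b j x < y" "iter b (Suc j) x < neg_beta b y"
      then have "\<lfloor>b * iter b j x\<rfloor> < \<lfloor>b * y\<rfloor>" using b by (intro floor_less_of_neg_beta_le) auto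
      then show ?thesis using w[of j] j by simp
    qed
  qed
qed

text \<open>For a point \<open>y\<close> of the same orbit, the criterion
  \<open>digit_ge_iff\<close> only compares orbit points, and the pattern decides these comparisons.
  The image of \<open>y\<close> is compared too, hence the bound \<open>Suc k < n\<close>.\<close>

lemma is_Pat_digits_eq:
  assumes b: "b > 0" "\<lfloor>b\<rfloor> \<le> int N" "x \<in> {0<..1}"
    and b': "b' > 0" "\<lfloor>b'\<rfloor> \<le> int N" "x' \<in> {0<..1}"
    and pat: "is_Pat x (neg_beta b) n \<pi>" "is_Pat x' (neg_beta b') n \<pi>"
    and N: "N + 2 \<le> n" and inc: "\<And>k. k \<le> N \<Longrightarrow> iter b k x < iter b (Suc k) x"
    and k: "Suc k < n"
  shows "\<lfloor>b * iter b k x\<rfloor> = \<lfloor>b' * iter b' k x'\<rfloor>"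
proof -
  have iff: "iter b i x < iter b j x \<longleftrightarrow> iter b' i x' < iter b' j x'" if "i < n" "j < n" for i j
    using is_Pat_less_iff[OF pat(1) that] is_Pat_less_iff[OF pat(2) that] by simp
  have inc': "iter b' k x' < iter b' (Suc k) x'" if "k \<le> N" for k
    using inc[OF that] iff[of k "Suc k"] that N by simp
  have bound: "0 \<le> \<lfloor>b * iter b k x\<rfloor> \<and> \<lfloor>b * iter b k x\<rfloor> \<le> int N"
    if "b > 0" "\<lfloor>b\<rfloor> \<le> int N" "x \<in> {0<..1}" for b x
  proof -
    have "0 < iter b k x" "iter b k x \<le> 1" using iter_in_unit[OF that(3), where k = k and b = b] by auto
    then have "0 \<le> b * iter b k x" "b * iter b k x \<le> b" using that by auto
    then show ?thesis using that(2) by (meson floor_mono order.trans zero_le_floor)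
  qed
  have "int j \<le> \<lfloor>b * iter b k x\<rfloor> \<longleftrightarrow> int j \<le> \<lfloor>b' * iter b' k x'\<rfloor>" if "j \<le> N" for j
  proof (cases j)
    case 0
    then show ?thesis using bound[OF b] bound[OF b'] by simp
  next
    case (Suc i)
    have "int (Suc i) \<le> \<lfloor>b * iter b k x\<rfloor> \<longleftrightarrow>
      \<not> iter b k x < iter b (Suc i) x \<or> iter b i x < iter b k x \<and> iter b (Suc i) x < iter b (Suc k) x"
      using digit_ge_iff[OF b, of i "iter b k x"] inc that Suc by (simp add: not_less)
    also have "\<dots> \<longleftrightarrow> \<not> iter b' k x' < iter b' (Suc i) x' \<or>
      iter b' i x' < iter b' k x' \<and> iter b' (Suc i) x' < iter b' (Suc k) x'"
      using iff[of k "Suc i"] iff[of i k] iff[of "Suc i" "Suc k"] k N that Suc by simp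
    also have "\<dots> \<longleftrightarrow> int (Suc i) \<le> \<lfloor>b' * iter b' k x'\<rfloor>"
      using digit_ge_iff[OF b', of i "iter b' k x'"] inc' that Suc by (simp add: not_less)
    finally show ?thesis using Suc by simp
  qed
  from this[of "nat \<lfloor>b * iter b k x\<rfloor>"] this[of "nat \<lfloor>b' * iter b' k x'\<rfloor>"] bound[OF b] bound[OF b']
  show ?thesis by force
qed

section \<open>The bases in which a pattern occurs\<close>

definition base_set :: "nat \<Rightarrow> (nat \<Rightarrow> nat) \<Rightarrow> real set" where
  "base_set n \<pi> = {b. b > 1 \<and> (n, \<pi>) \<in> allowed_patterns {0<..1} (neg_beta b)}"

lemma base_setI: "b > 1 \<Longrightarrow> n \<ge> 1 \<Longrightarrow> x \<in> {0<..1} \<Longrightarrow> is_Pat x (neg_beta b) n \<pi> \<Longrightarrow> b \<in> base_set n \<pi>"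
  by (auto simp: base_set_def allowed_patterns_def)

lemma base_setE:
  assumes "b \<in> base_set n \<pi>"
  obtains x where "b > 1" "x \<in> {0<..1}" "is_Pat x (neg_beta b) n \<pi>"
  using assms by (auto simp: base_set_def allowed_patterns_def)

lemma B_minus_eq: "B_minus n \<pi> = Inf (base_set n \<pi>)"
  by (simp add: B_minus_def base_set_def)

lemma bdd_below_base_set: "bdd_below (base_set n \<pi>)"
  by (auto simp: base_set_def intro!: bdd_belowI[of _ 1])

text \<open>In the integer base \<open>n + 1\<close> every word of digits up to \<open>n\<close> can
  be prescribed. With the values of \<open>\<pi>\<close> as digits, the digits alone order the
  points.\<close>

lemma base_set_nonempty:
  assumes "n \<ge> 1" "\<pi> permutes {1..n}"
  shows "base_set n \<pi> \<noteq> {}"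
proof -
  define b where "b = real n + 1"
  define d where "d k = int (\<pi> (Suc k))" for k
  have d: "1 \<le> d k \<and> d k \<le> int n" if "k < n" for k
    using permutes_in_image[OF assms(2), of "Suc k"] that by (auto simp: d_def)
  have "of_int (d k) \<le> real n" if "k < n" for k
    using d[OF that] by linarith
  then have d': "0 \<le> d k \<and> of_int (d k) + 1 \<le> b" if "k < n" for k
    using d[OF that] that by (simp add: b_def)
  then obtain x where x: "\<And>k. k \<le> n \<Longrightarrow> 0 < orb d b x k \<and> orb d b x k < 1"
    using ex_orb_endpoint[of b "1/2" n d] by (auto simp: b_def)
  have it: "orb d b x k = iter b k x" if "k < n" for k
    using x that by (intro orb_eq_iter[of n]) (auto simp: less_imp_le)
  have "is_Pat x (neg_beta b) n \<pi>"
  proof (rule is_PatI[OF assms(2)])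
    fix i j assume ij: "i < n" "j < n" "\<pi> (Suc i) < \<pi> (Suc j)"
    have "\<lfloor>b * orb d b x i\<rfloor> = d i" "\<lfloor>b * orb d b x j\<rfloor> = d j"
      using x[of "Suc i"] x[of "Suc j"] ij by (auto intro!: orb_digit)
    then have "\<lfloor>b * orb d b x i\<rfloor> < \<lfloor>b * orb d b x j\<rfloor>" using ij by (simp add: d_def)
    then have "b * orb d b x i < b * orb d b x j" by (meson floor_less_cancel)
    then show "iter b i x < iter b j x" using it ij by (simp add: b_def)
  qed
  moreover have "x \<in> {0<..1}" using x[of 0] by simp
  ultimately show ?thesis
    using base_setI[of b n x \<pi>] assms by (auto simp: b_def)
qed

lemma B_minus_less_imp:
  assumes "n \<ge> 1" "\<pi> permutes {1..n}" "B_minus n \<pi> < t"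
  shows "\<exists>b\<in>base_set n \<pi>. b < t"
  using assms base_set_nonempty cInf_lessD unfolding B_minus_eq by blast

lemma not_inj_nat:
  fixes f :: "nat \<Rightarrow> 'a"
  assumes "\<not> inj f"
  shows "\<exists>i j. i < j \<and> f i = f j"
proof -
  obtain i j where "f i = f j" "i \<noteq> j" using assms by (auto simp: inj_def)
  then show ?thesis by (metis linorder_neqE_nat)
qed

text \<open>If the digits from two times on agree, the distance of the two orbit points is
  multiplied by \<open>b\<close> in each step but stays at most 1, so it is 0. Conversely, equal
  points have equal digits from there on.\<close>

lemma Yrrap_iff: "Yrrap b \<longleftrightarrow> b > 1 \<and> \<not> inj (\<lambda>k. iter b k 1)"
proof -
  have "eventually_periodic (neg_digit b 1) \<longleftrightarrow> \<not> inj (\<lambda>k. iter b k 1)" if "b > 1"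
  proof
    assume "eventually_periodic (neg_digit b 1)"
    then obtain m p where p: "p \<ge> 1" "\<And>k. k > m \<Longrightarrow> neg_digit b 1 (k + p) = neg_digit b 1 k"
      by (auto simp: eventually_periodic_def)
    define d where "d j = \<lfloor>b * iter b j 1\<rfloor>" for j
    have d: "d (m + p + j) = d (m + j)" for j
      using p(2)[of "Suc (m + j)"] by (simp add: neg_digit_def d_def ac_simps)
    define e where "e = iter b (m + p) 1 - iter b m 1"
    have "\<bar>b ^ k * e\<bar> \<le> 1" for k
    proof -
      have orb: "iter b j 1 = orb d b 1 j" for j
        unfolding d_def by (rule iter_eq_orb)
      have "iter b (m + p + k) 1 - iter b (m + k) 1 = (- b) ^ k * e"
        unfolding orb e_def orb_add by (simp only: d orb_diff)
      moreover have "iter b j 1 \<in> {0<..1}" for j by (rule iter_in_unit) simp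
      then have "\<bar>iter b (m + p + k) 1 - iter b (m + k) 1\<bar> \<le> 1"
        by (smt (verit) greaterThanAtMost_iff)
      ultimately show ?thesis by (simp add: abs_mult power_abs)
    qed
    moreover have "\<exists>k. 1 < b ^ k * \<bar>e\<bar>" if "e \<noteq> 0"
    proof -
      obtain k where "1 / \<bar>e\<bar> < b ^ k" using real_arch_pow[OF \<open>b > 1\<close>] by blast
      then have "1 < b ^ k * \<bar>e\<bar>" using that by (simp add: field_simps)
      then show ?thesis by blast
    qed
    ultimately have "e = 0" using that by (auto simp: abs_mult not_less[symmetric])
    then show "\<not> inj (\<lambda>k. iter b k 1)"
      using p(1) by (auto simp: e_def dest!: injD[of _ "m + p" m])
  next
    assume "\<not> inj (\<lambda>k. iter b k 1)"
    then obtain i j where ij: "i < j" "iter b i 1 = iter b j 1"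
      using not_inj_nat by blast
    have "neg_digit b 1 (k + (j - i)) = neg_digit b 1 k" if "k > i" for k
    proof -
      have "iter b (k + (j - i) - 1) 1 = iter b (k - 1) 1"
        using iter_add[where b = b and i = i and k = "k - 1 - i" and x = 1]
          iter_add[where b = b and i = j and k = "k - 1 - i" and x = 1] ij that
        by (simp add: algebra_simps)
      then show ?thesis by (simp add: neg_digit_def)
    qed
    then show "eventually_periodic (neg_digit b 1)"
      unfolding eventually_periodic_def using ij by (intro exI[of _ i] exI[of _ "j - i"]) auto
  qed
  then show ?thesis by (auto simp: Yrrap_def)
qed

section \<open>Bases of patterns are Yrrap numbers\<close>

text \<open>By \<open>pow_diff_sign\<close> the sign depends only on the two exponents and not on
  the base.\<close>

lemma pow_diff_same_sign:
  fixes b b' :: real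
  assumes "b > 1" "b' > 1" "i \<noteq> j"
  shows "0 < ((- b) ^ j - (- b) ^ i) * ((- b') ^ j - (- b') ^ i)"
proof -
  have *: "0 < ((- b) ^ j - (- b) ^ i) * ((- b') ^ j - (- b') ^ i)" if "i < j" for i j
  proof -
    have "0 < ((- 1) ^ j * ((- b) ^ j - (- b) ^ i)) * ((- 1) ^ j * ((- b') ^ j - (- b') ^ i))"
      using pow_diff_sign[OF assms(1) that] pow_diff_sign[OF assms(2) that] by (rule mult_pos_pos)
    also have "\<dots> = ((- 1) ^ j * (- 1) ^ j) * (((- b) ^ j - (- b) ^ i) * ((- b') ^ j - (- b') ^ i))"
      by (simp only: ac_simps)
    also have "((- 1) ^ j * (- 1) ^ j :: real) = 1"
      by (simp flip: power_mult_distrib)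
    finally show ?thesis by simp
  qed
  show ?thesis
    using *[of i j] *[of j i] assms(3) by (cases "i < j") (auto simp: algebra_simps)
qed

lemma eq_if_int_diff:
  fixes x y :: real
  assumes "x - y = of_int k" "\<bar>x - y\<bar> < 1"
  shows "x = y"
proof -
  have "k = 0" using assms by linarith
  then show ?thesis using assms by simp
qed

lemma first_return:
  fixes y :: "nat \<Rightarrow> 'a"
  assumes "\<not> inj y"
  obtains m K where "m < K" "y K = y m" "inj_on y {..<K}"
proof -
  define K where "K = (LEAST K. \<exists>m<K. y K = y m)"
  have "\<exists>K. \<exists>m<K. y K = y m"
    using not_inj_nat[OF assms] by metis
  then have "\<exists>m<K. y K = y m"
    unfolding K_def by (rule LeastI_ex)
  moreover have "inj_on y {..<K}"
  proof (rule inj_onI)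
    fix i j assume "i \<in> {..<K}" "j \<in> {..<K}" "y i = y j"
    then show "i = j"
      using not_less_Least[of i "\<lambda>K. \<exists>m<K. y K = y m"] not_less_Least[of j "\<lambda>K. \<exists>m<K. y K = y m"]
      by (metis K_def lessThan_iff linorder_neqE_nat)
  qed
  ultimately show ?thesis using that by blast
qed

text \<open>Bases of realizations converge to the infimum from above. A fixed digit word and
  convergent starting points give a limit orbit on which strict inequalities survive as weak ones.
  One actual realization with the same word is kept as \<open>b\<close> and \<open>u\<close>, since
  it still knows the strict order.\<close>

lemma limit_realization:
  assumes n: "n \<ge> 1" and perm: "\<pi> permutes {1..n}" and \<beta>: "B_minus n \<pi> = \<beta>" "\<beta> > 1"
  obtains w x b u where "\<And>k. 0 \<le> w k" "\<And>k. 0 \<le> orb w \<beta> x k \<and> orb w \<beta> x k \<le> 1"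
    "\<And>i j. i < n \<Longrightarrow> j < n \<Longrightarrow> \<pi> (Suc i) < \<pi> (Suc j) \<Longrightarrow> orb w \<beta> x i \<le> orb w \<beta> x j"
    "b > 1"
    "\<And>i j. i < n \<Longrightarrow> j < n \<Longrightarrow> \<pi> (Suc i) < \<pi> (Suc j) \<Longrightarrow> orb w b u i < orb w b u j"
proof -
  have "\<exists>b u. b \<in> base_set n \<pi> \<and> b < \<beta> + 1 / real (Suc r) \<and> u \<in> {0<..1} \<and> is_Pat u (neg_beta b) n \<pi>" for r
    using B_minus_less_imp[OF n perm, of "\<beta> + 1 / real (Suc r)"] \<beta> by (fastforce elim: base_setE)
  then obtain B U where BU: "\<And>r. B r \<in> base_set n \<pi>" "\<And>r. B r < \<beta> + 1 / real (Suc r)"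
    "\<And>r. U r \<in> {0<..1}" "\<And>r. is_Pat (U r) (neg_beta (B r)) n \<pi>"
    by metis
  have Bge: "\<beta> \<le> B r" for r
    using cInf_lower[OF BU(1) bdd_below_base_set] \<beta> by (simp add: B_minus_eq)
  define D where "D r k = \<lfloor>B r * iter (B r) k (U r)\<rfloor>" for r k
  have unit: "0 < iter (B r) k (U r) \<and> iter (B r) k (U r) \<le> 1" for r k
    using iter_in_unit[OF BU(3)] by simp
  have D0: "0 \<le> D r k" for r k
    using unit[of k r] Bge[of r] \<beta> by (simp add: D_def)
  have D1: "D r k \<le> \<lfloor>\<beta> + 1\<rfloor>" for r k
  proof -
    have "B r * iter (B r) k (U r) \<le> B r"
      using unit[of k r] Bge[of r] \<beta> by simp
    also have "\<dots> \<le> \<beta> + 1" using BU(2)[of r] by (smt (verit) divide_le_eq_1 of_nat_Suc of_nat_0_le_iff)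
    finally show ?thesis unfolding D_def by (rule floor_mono)
  qed
  \<comment> \<open>The digits are bounded uniformly in \<open>r\<close>, so some word of length
    \<open>n\<close> occurs infinitely often.\<close>
  have "finite ((\<lambda>r. map (D r) [0..<n]) ` UNIV)"
  proof (rule finite_subset)
    show "(\<lambda>r. map (D r) [0..<n]) ` UNIV \<subseteq> {xs. set xs \<subseteq> {0..\<lfloor>\<beta> + 1\<rfloor>} \<and> length xs = n}"
      using D0 D1 by auto
    show "finite {xs. set xs \<subseteq> {0..\<lfloor>\<beta> + 1\<rfloor>} \<and> length xs = n}"
      by (rule finite_lists_length_eq) simp
  qed
  then obtain r0 where "infinite {r. map (D r) [0..<n] = map (D r0) [0..<n]}"
    using pigeonhole_infinite[of "UNIV :: nat set" "\<lambda>r. map (D r) [0..<n]"] by auto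
  moreover define R where "R = {r. map (D r) [0..<n] = map (D r0) [0..<n]}"
  ultimately have R: "infinite R" by simp
  obtain e :: "nat \<Rightarrow> nat" where e: "strict_mono e" "\<And>i. e i \<in> R"
    using infinite_enumerate[OF R] by blast
  obtain g where g: "strict_mono g" "monoseq (\<lambda>i. U (e (g i)))"
    using seq_monosub[of "U \<circ> e"] by (auto simp: o_def)
  define h where "h i = e (g i)" for i
  have h: "strict_mono h" using e g by (simp add: h_def strict_mono_def)
  have "Bseq (\<lambda>i. U (h i))"
  proof (rule BseqI'[of _ 1])
    show "norm (U (h i)) \<le> 1" for i using BU(3)[of "h i"] by simp
  qed
  then obtain x where x: "(\<lambda>i. U (h i)) \<longlonglongrightarrow> x"
    using Bseq_monoseq_convergent g unfolding h_def convergent_def by blast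
  have "(\<lambda>r. \<beta> + 1 / real (Suc r)) \<longlonglongrightarrow> \<beta> + 0"
    by (intro tendsto_intros LIMSEQ_Suc lim_1_over_n)
  then have "B \<longlonglongrightarrow> \<beta>"
    using Bge BU(2) by (intro tendsto_sandwich[of "\<lambda>_. \<beta>" B _ "\<lambda>r. \<beta> + 1 / real (Suc r)"])
      (auto intro!: always_eventually less_imp_le)
  then have Blim: "(\<lambda>i. B (h i)) \<longlonglongrightarrow> \<beta>"
    using LIMSEQ_subseq_LIMSEQ[OF _ h] by (auto simp: o_def)
  define w0 where "w0 = D r0"
  have orb_h: "iter (B (h i)) k (U (h i)) = orb w0 (B (h i)) (U (h i)) k" if "k < n" for i k
  proof -
    have "map (D (h i)) [0..<n] = map w0 [0..<n]"
      using e(2)[of "g i"] by (simp add: R_def h_def w0_def)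
    then have "D (h i) j = w0 j" if "j < n" for j
      using that by (simp add: map_eq_conv)
    then have "orb (D (h i)) (B (h i)) (U (h i)) k = orb w0 (B (h i)) (U (h i)) k"
      using that by (intro orb_cong) auto
    then show ?thesis
      unfolding D_def by (subst iter_eq_orb)
  qed
  have lim: "(\<lambda>i. iter (B (h i)) k (U (h i))) \<longlonglongrightarrow> orb w0 \<beta> x k" if "k < n" for k
    unfolding orb_h[OF that] by (rule tendsto_orb[OF Blim x])
  have y_unit: "0 \<le> orb w0 \<beta> x k \<and> orb w0 \<beta> x k \<le> 1" if "k < n" for k
    using LIMSEQ_le_const[OF lim[OF that], of 0] LIMSEQ_le_const2[OF lim[OF that], of 1] unit
    by (meson less_imp_le)
  have y_less: "orb w0 \<beta> x i \<le> orb w0 \<beta> x j" if "i < n" "j < n" "\<pi> (Suc i) < \<pi> (Suc j)" for i j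
    using LIMSEQ_le[OF lim[OF that(1)] lim[OF that(2)]] is_Pat_less_iff[OF BU(4) that(1,2)] that(3)
    by (auto intro: less_imp_le)
  \<comment> \<open>From time \<open>n - 1\<close> on the word is continued by the true digits of
    \<open>y0\<close>, so that the infinite orbit remains in the closed unit interval. The points at
    times below \<open>n\<close> do not change.\<close>
  define y0 where "y0 = orb w0 \<beta> x (n - 1)"
  define w where "w k = (if k < n - 1 then w0 k else \<lfloor>\<beta> * iter \<beta> (k - (n - 1)) y0\<rfloor>)" for k
  have orb_w: "orb w b u k = orb w0 b u k" if "k < n" for b u k
    using that by (intro orb_cong) (auto simp: w_def)
  have orb_tail: "orb w \<beta> x (n - 1 + l) = iter \<beta> l y0" for l
  proof -
    have "orb w \<beta> x (n - 1) = y0"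
      using orb_w n by (simp add: y0_def)
    then have "orb w \<beta> x (n - 1 + l) = orb (\<lambda>j. w (n - 1 + j)) \<beta> y0 l"
      by (simp only: orb_add)
    also have "\<dots> = orb (\<lambda>j. \<lfloor>\<beta> * iter \<beta> j y0\<rfloor>) \<beta> y0 l"
      by (simp add: w_def)
    also have "\<dots> = iter \<beta> l y0"
      by (rule iter_eq_orb[symmetric])
    finally show ?thesis .
  qed
  have tail_unit: "0 \<le> iter \<beta> l y0 \<and> iter \<beta> l y0 \<le> 1" for l
  proof (cases l)
    case 0
    then show ?thesis using y_unit n by (simp add: y0_def)
  next
    case (Suc i)
    then show ?thesis using neg_beta_in_unit[of \<beta> "iter \<beta> i y0"] by simp
  qed
  show ?thesis
  proof (rule that[of w x "B (h 0)" "U (h 0)"])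
    fix k
    show "0 \<le> w k"
      using D0 tail_unit \<beta> by (simp add: w_def w0_def)
    show "0 \<le> orb w \<beta> x k \<and> orb w \<beta> x k \<le> 1"
    proof (cases "k < n")
      case True
      then show ?thesis using y_unit orb_w by simp
    next
      case False
      then show ?thesis using orb_tail[of "k - (n - 1)"] tail_unit by simp
    qed
  next
    show "1 < B (h 0)" using Bge[of "h 0"] \<beta> by simp
  next
    fix i j assume ij: "i < n" "j < n" "\<pi> (Suc i) < \<pi> (Suc j)"
    then show "orb w \<beta> x i \<le> orb w \<beta> x j" using y_less orb_w by simp
    show "orb w (B (h 0)) (U (h 0)) i < orb w (B (h 0)) (U (h 0)) j"
      using is_Pat_less_iff[OF BU(4)[of "h 0"] ij(1,2)] ij orb_w orb_h[of _ 0] by simp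
  qed
qed

text \<open>If the orbit of \<open>1\<close> is infinite, then all constraints that are tight at a limit point of
  realizations amount to a single one, so they can be satisfied simultaneously by moving the
  starting point in one direction \<open>s\<close>.\<close>

lemma tight_constraints_compatible:
  fixes \<pi> :: "nat \<Rightarrow> nat"
  assumes \<beta>: "\<beta> > 1" and inj1: "inj (\<lambda>k. iter \<beta> k 1)"
    and w: "\<And>k. 0 \<le> w k" and unit: "\<And>k. 0 \<le> orb w \<beta> x k \<and> orb w \<beta> x k \<le> 1"
    and b: "b > 1"
    and real: "\<And>i j. i < n \<Longrightarrow> j < n \<Longrightarrow> \<pi> (Suc i) < \<pi> (Suc j) \<Longrightarrow> orb w b u i < orb w b u j"
  obtains s :: real where
    "\<And>k. orb w \<beta> x k = 0 \<Longrightarrow> 0 < (- \<beta>) ^ k * s"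
    "\<And>k. orb w \<beta> x k = 1 \<Longrightarrow> (- \<beta>) ^ k * s < 0"
    "\<And>i j. i < n \<Longrightarrow> j < n \<Longrightarrow> \<pi> (Suc i) < \<pi> (Suc j) \<Longrightarrow> orb w \<beta> x i = orb w \<beta> x j \<Longrightarrow>
      0 < ((- \<beta>) ^ j - (- \<beta>) ^ i) * s"
proof -
  define y where "y = orb w \<beta> x"
  define c where "c k = iter \<beta> k 1" for k
  have y_Suc: "y (Suc k) = of_int (w k) + 1 - \<beta> * y k" for k by (simp add: y_def)
  have y01: "0 \<le> y k" "y k \<le> 1" for k using unit by (auto simp: y_def)
  have inj_c: "c i = c j \<Longrightarrow> i = j" for i j using inj1 by (auto simp: c_def dest: injD)
  have c_Suc: "c (Suc k) = neg_beta \<beta> (c k)" for k by (simp add: c_def)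
  have c01: "0 < c k" "c k \<le> 1" for k
    using iter_in_unit[of 1, where b = \<beta> and k = k] by (auto simp: c_def)
  have c_lt1: "c (Suc k) < 1" for k
    using c01[of "Suc k"] inj_c[of "Suc k" 0] by (force simp: c_def)
  \<comment> \<open>Two candidates for the next point differ by an integer. Since the orbit of 1
    never returns to 1, that integer is less than 1 in absolute value.\<close>
  have after1: "y (k + l) = c l" if "y k = 1" for k l
  proof (induction l)
    case 0
    then show ?case using that by (simp add: c_def)
  next
    case (Suc l)
    have "y (Suc (k + l)) - c (Suc l) = of_int (w (k + l) - \<lfloor>\<beta> * c l\<rfloor>)"
      unfolding y_Suc c_Suc neg_beta_def Suc by simp
    moreover have "\<bar>y (Suc (k + l)) - c (Suc l)\<bar> < 1"
      using y01[of "Suc (k + l)"] c01(1)[of "Suc l"] c_lt1[of l] by linarith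
    ultimately show ?case by (metis eq_if_int_diff add_Suc_right)
  qed
  have after0: "y (Suc k) = 1" if "y k = 0" for k
    using y_Suc[of k] y01[of "Suc k"] w[of k] that by simp
  show ?thesis
  \<comment> \<open>An orbit that meets 1 does so exactly once and has no coincidences, so only 1
    and a 0 just before it are tight. An orbit that avoids 1 also avoids 0, and only coincidences
    can be tight. In the first case \<open>b\<close> denotes a time and hides the base.\<close>
  proof (cases "\<exists>b. y b = 1")
    case True
    then obtain b where b1: "y b = 1" by blast
    have uniq: "k = b" if "y k = 1" for k
    proof -
      have "c (b - k) = c 0" if "k \<le> b"
        using after1[OF \<open>y k = 1\<close>, of "b - k"] b1 that by (simp add: c_def)
      moreover have "c (k - b) = c 0" if "b \<le> k"
        using after1[OF b1, of "k - b"] \<open>y k = 1\<close> that by (simp add: c_def)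
      ultimately show ?thesis using inj_c by (metis diff_is_0_eq nat_le_linear order_antisym)
    qed
    have zero: "Suc k = b" if "y k = 0" for k
      using uniq[OF after0[OF that]] .
    \<comment> \<open>A coincidence persists: to break, it would need 0 and 1 at the same shift,
      which contradicts the unique time of 1. It would thus persist until one index is shifted past
      \<open>b\<close>, giving a coincidence in the orbit of 1.\<close>
    have ne: "y i \<noteq> y j" if "i < j" for i j
    proof
      assume eq: "y i = y j"
      have "y (i + r) = y (j + r)" for r
      proof (induction r)
        case 0
        then show ?case using eq by simp
      next
        case (Suc r)
        have d: "y (Suc (i + r)) - y (Suc (j + r)) = of_int (w (i + r) - w (j + r))"
          unfolding y_Suc Suc by simp
        show ?case
        proof (rule ccontr)
          assume "y (i + Suc r) \<noteq> y (j + Suc r)"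
          then have "w (i + r) - w (j + r) \<noteq> 0" using d by auto
          then have "1 \<le> \<bar>w (i + r) - w (j + r)\<bar>" by linarith
          then have "1 \<le> \<bar>y (Suc (i + r)) - y (Suc (j + r))\<bar>"
            unfolding d by linarith
          then consider "y (Suc (i + r)) = 0" "y (Suc (j + r)) = 1"
            | "y (Suc (i + r)) = 1" "y (Suc (j + r)) = 0"
            using y01[of "Suc (i + r)"] y01[of "Suc (j + r)"] by linarith
          then show False
          proof cases
            case 1
            then have "Suc (Suc (i + r)) = b" "Suc (j + r) = b" using zero uniq by auto
            then have "j = Suc i" by simp
            then have "y (i + r) = 0" using Suc 1 by simp
            then show False using after0 1 by fastforce
          next
            case 2
            then have "Suc (i + r) = b" "Suc (Suc (j + r)) = b" using zero uniq by auto
            then show False using that by simp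
          qed
        qed
      qed
      from this[of b] have "c i = c j"
        using after1[OF b1, of i] after1[OF b1, of j] by (simp add: add.commute)
      then show False using inj_c that by blast
    qed
    \<comment> \<open>With this sign the point at time \<open>b\<close> moves below 1, and a 0 at
      the previous time then moves above 0.\<close>
    define s where "s = - ((- 1) ^ b :: real)"
    have pm: "(- \<beta>) ^ k = \<beta> ^ k * (- 1) ^ k" for k
      by (simp flip: power_mult_distrib)
    have sq: "(- 1) ^ k * (- 1) ^ k = (1 :: real)" for k :: nat
      by (simp flip: power_mult_distrib)
    show ?thesis
    proof (rule that[of s])
      fix k assume "orb w \<beta> x k = 0"
      then have k: "Suc k = b" using zero by (simp add: y_def)
      have "(- \<beta>) ^ k * s = \<beta> ^ k"
        unfolding s_def pm k[symmetric] by (simp add: mult.assoc sq)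
      then show "0 < (- \<beta>) ^ k * s" using \<beta> by simp
    next
      fix k assume "orb w \<beta> x k = 1"
      then have k: "k = b" using uniq by (simp add: y_def)
      have "(- \<beta>) ^ k * s = - (\<beta> ^ k)"
        unfolding s_def pm k by (simp add: mult.assoc sq)
      then show "(- \<beta>) ^ k * s < 0" using \<beta> by simp
    next
      fix i j assume "\<pi> (Suc i) < \<pi> (Suc j)" "orb w \<beta> x i = orb w \<beta> x j"
      then show "0 < ((- \<beta>) ^ j - (- \<beta>) ^ i) * s"
        using ne[of i j] ne[of j i] by (cases i j rule: linorder_cases) (auto simp: y_def)
    qed
  next
    case False
    have no1: "y k \<noteq> 1" for k using False by blast
    have no0: "y k \<noteq> 0" for k using after0[of k] no1 by blast
    have in01: "0 < y k" "y k < 1" for k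
      using y01[of k] no0[of k] no1[of k] by auto
    have det: "y (Suc j) = y (Suc k) \<and> w j = w k" if "y j = y k" for j k
    proof -
      have "y (Suc j) - y (Suc k) = of_int (w j - w k)"
        unfolding y_Suc that by simp
      moreover have "\<bar>y (Suc j) - y (Suc k)\<bar> < 1"
        using in01[of "Suc j"] in01[of "Suc k"] by linarith
      ultimately have "\<bar>w j - w k\<bar> < 1" by linarith
      then show ?thesis using \<open>y (Suc j) - y (Suc k) = of_int (w j - w k)\<close> by simp
    qed
    obtain s where s: "\<And>i j. i < n \<Longrightarrow> j < n \<Longrightarrow> \<pi> (Suc i) < \<pi> (Suc j) \<Longrightarrow> y i = y j \<Longrightarrow>
      0 < ((- \<beta>) ^ j - (- \<beta>) ^ i) * s"
    proof (cases "inj y")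
      case True
      show ?thesis
      proof (rule that[of 0])
        fix i j assume "\<pi> (Suc i) < \<pi> (Suc j)" "y i = y j"
        then show "0 < ((- \<beta>) ^ j - (- \<beta>) ^ i) * 0" using injD[OF True, of i j] by simp
      qed
    next
      case False
      then obtain m K where K: "m < K" "y K = y m" "inj_on y {..<K}"
        by (rule first_return)
      define \<xi> where "\<xi> = periodic_start w m K b"
      have xi: "orb w b \<xi> i = orb w b \<xi> j" if "y i = y j" for i j
        using orb_collapse[OF det K orb_periodic_start[OF b K(1)] that] by (simp add: \<xi>_def)
      \<comment> \<open>All coincidences of \<open>y\<close> also hold for the orbit of
        \<open>\<xi>\<close> in base \<open>b\<close>. The strict realization \<open>u\<close> lies
        on the side of \<open>\<xi>\<close> that separates them correctly, and the correct side is
        the same in base \<open>\<beta>\<close>.\<close>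
      show ?thesis
      proof (rule that[of "u - \<xi>"])
        fix i j assume ij: "i < n" "j < n" "\<pi> (Suc i) < \<pi> (Suc j)" "y i = y j"
        have "orb w b u i - orb w b u j = ((- b) ^ i - (- b) ^ j) * (u - \<xi>)"
          using orb_diff[of w b u i \<xi>] orb_diff[of w b u j \<xi>] xi[OF ij(4)]
          by (simp add: left_diff_distrib)
        then have "0 < ((- b) ^ j - (- b) ^ i) * (u - \<xi>)"
          using real[OF ij(1-3)] by (simp add: algebra_simps)
        moreover have "0 < ((- b) ^ j - (- b) ^ i) * ((- \<beta>) ^ j - (- \<beta>) ^ i)"
          using pow_diff_same_sign[OF b \<beta>, of i j] ij by fastforce
        ultimately show "0 < ((- \<beta>) ^ j - (- \<beta>) ^ i) * (u - \<xi>)"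
          by (auto simp: zero_less_mult_iff)
      qed
    qed
    show ?thesis
      using that[of s] s no0 no1 by (simp add: y_def)
  qed
qed

text \<open>Two perturbations contradict the infimum: a small move of the starting point makes all
  constraints strict in base \<open>\<beta>\<close>, and strict constraints survive a slight
  decrease of the base.\<close>

lemma B_minus_imp_Yrrap:
  assumes n: "n \<ge> 1" and perm: "\<pi> permutes {1..n}" and \<beta>: "B_minus n \<pi> = \<beta>" "\<beta> > 1"
  shows "Yrrap \<beta>"
proof (rule ccontr)
  assume "\<not> Yrrap \<beta>"
  then have inj1: "inj (\<lambda>k. iter \<beta> k 1)" using \<beta> by (simp add: Yrrap_iff)
  obtain w x b u where w: "\<And>k. 0 \<le> w k" "\<And>k. 0 \<le> orb w \<beta> x k \<and> orb w \<beta> x k \<le> 1"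
    "\<And>i j. i < n \<Longrightarrow> j < n \<Longrightarrow> \<pi> (Suc i) < \<pi> (Suc j) \<Longrightarrow> orb w \<beta> x i \<le> orb w \<beta> x j"
    "b > 1"
    "\<And>i j. i < n \<Longrightarrow> j < n \<Longrightarrow> \<pi> (Suc i) < \<pi> (Suc j) \<Longrightarrow> orb w b u i < orb w b u j"
    by (rule limit_realization[OF n perm \<beta>]) blast
  obtain s :: real where s:
    "\<And>k. orb w \<beta> x k = 0 \<Longrightarrow> 0 < (- \<beta>) ^ k * s"
    "\<And>k. orb w \<beta> x k = 1 \<Longrightarrow> (- \<beta>) ^ k * s < 0"
    "\<And>i j. i < n \<Longrightarrow> j < n \<Longrightarrow> \<pi> (Suc i) < \<pi> (Suc j) \<Longrightarrow> orb w \<beta> x i = orb w \<beta> x j \<Longrightarrow>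
      0 < ((- \<beta>) ^ j - (- \<beta>) ^ i) * s"
    using w(5) by (rule tight_constraints_compatible[where n = n and \<pi> = \<pi>, OF \<beta>(2) inj1 w(1,2,4)]) blast+
  have orb_t: "orb w \<beta> (x + s * t) k = orb w \<beta> x k + t * ((- \<beta>) ^ k * s)" for t k
    using orb_diff[of w \<beta> "x + s * t" k x] by (simp add: algebra_simps)
  have lim: "((\<lambda>t. orb w \<beta> (x + s * t) k) \<longlongrightarrow> orb w \<beta> x k) (at_right 0)" for k
  proof -
    have "((\<lambda>t. orb w \<beta> (x + s * t) k) \<longlongrightarrow> orb w \<beta> (x + s * 0) k) (at_right 0)"
      by (intro tendsto_orb tendsto_intros)
    then show ?thesis by simp
  qed
  have pos: "\<forall>\<^sub>F t in at_right (0::real). 0 < t"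
    by (rule eventually_at_right_less)
  have ev1: "\<forall>\<^sub>F t in at_right 0. 0 < orb w \<beta> (x + s * t) k" for k
  proof (cases "orb w \<beta> x k = 0")
    case True
    show ?thesis using pos
      by eventually_elim (use s(1)[OF True] in \<open>simp add: orb_t True\<close>)
  next
    case False
    then show ?thesis using w(2)[of k] by (intro order_tendstoD(1)[OF lim]) simp
  qed
  have ev2: "\<forall>\<^sub>F t in at_right 0. orb w \<beta> (x + s * t) k < 1" for k
  proof (cases "orb w \<beta> x k = 1")
    case True
    show ?thesis using pos
      by eventually_elim (use s(2)[OF True] in \<open>simp add: orb_t True mult_pos_neg\<close>)
  next
    case False
    then show ?thesis using w(2)[of k] by (intro order_tendstoD(2)[OF lim]) simp
  qed
  have ev3: "\<forall>\<^sub>F t in at_right 0. \<pi> (Suc i) < \<pi> (Suc j) \<longrightarrow>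
      orb w \<beta> (x + s * t) i < orb w \<beta> (x + s * t) j" if "i < n" "j < n" for i j
  proof (cases "\<pi> (Suc i) < \<pi> (Suc j)")
    case True
    show ?thesis
    proof (cases "orb w \<beta> x i = orb w \<beta> x j")
      case eq: True
      show ?thesis using pos
      proof eventually_elim
        fix t :: real assume "0 < t"
        then have "0 < t * (((- \<beta>) ^ j - (- \<beta>) ^ i) * s)"
          using s(3)[OF that True eq] by simp
        then show "\<pi> (Suc i) < \<pi> (Suc j) \<longrightarrow> orb w \<beta> (x + s * t) i < orb w \<beta> (x + s * t) j"
          by (simp add: orb_t eq algebra_simps)
      qed
    next
      case False
      then have "0 < orb w \<beta> x j - orb w \<beta> x i" using w(3)[OF that True] by simp
      then have "\<forall>\<^sub>F t in at_right 0. 0 < orb w \<beta> (x + s * t) j - orb w \<beta> (x + s * t) i"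
        by (intro order_tendstoD(1)[OF tendsto_diff[OF lim lim]])
      then show ?thesis by eventually_elim simp
    qed
  qed simp
  have "\<forall>\<^sub>F t in at_right 0. (\<forall>k\<in>{..<n}. 0 < orb w \<beta> (x + s * t) k) \<and> (\<forall>k\<in>{..<n}. orb w \<beta> (x + s * t) k < 1) \<and>
      (\<forall>i\<in>{..<n}. \<forall>j\<in>{..<n}. \<pi> (Suc i) < \<pi> (Suc j) \<longrightarrow> orb w \<beta> (x + s * t) i < orb w \<beta> (x + s * t) j)"
    by (intro eventually_conj eventually_ball_finite finite_lessThan ballI ev1 ev2 ev3) auto
  then obtain t where t: "\<And>k. k < n \<Longrightarrow> 0 < orb w \<beta> (x + s * t) k"
    "\<And>k. k < n \<Longrightarrow> orb w \<beta> (x + s * t) k < 1"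
    "\<And>i j. i < n \<Longrightarrow> j < n \<Longrightarrow> \<pi> (Suc i) < \<pi> (Suc j) \<Longrightarrow> orb w \<beta> (x + s * t) i < orb w \<beta> (x + s * t) j"
    by (rule exE[OF eventually_happens'[OF trivial_limit_at_right_real]]) blast
  \<comment> \<open>The starting point is now fixed, and only the base varies.\<close>
  define x' where "x' = x + s * t"
  have lim': "((\<lambda>b. orb w b x' k) \<longlongrightarrow> orb w \<beta> x' k) (at_left \<beta>)" for k
    by (intro tendsto_orb tendsto_intros)
  have ev3': "\<forall>\<^sub>F b in at_left \<beta>. \<pi> (Suc i) < \<pi> (Suc j) \<longrightarrow> orb w b x' i < orb w b x' j"
    if "i < n" "j < n" for i j
  proof (cases "\<pi> (Suc i) < \<pi> (Suc j)")
    case True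
    then have "0 < orb w \<beta> x' j - orb w \<beta> x' i" using t(3)[OF that True] by (simp add: x'_def)
    then have "\<forall>\<^sub>F b in at_left \<beta>. 0 < orb w b x' j - orb w b x' i"
      by (intro order_tendstoD(1)[OF tendsto_diff[OF lim' lim']])
    then show ?thesis by eventually_elim simp
  qed simp
  have ev1': "\<forall>\<^sub>F b in at_left \<beta>. 0 < orb w b x' k" if "k < n" for k
    by (rule order_tendstoD(1)[OF lim']) (use t(1)[OF that] in \<open>simp add: x'_def\<close>)
  have ev2': "\<forall>\<^sub>F b in at_left \<beta>. orb w b x' k < 1" if "k < n" for k
    by (rule order_tendstoD(2)[OF lim']) (use t(2)[OF that] in \<open>simp add: x'_def\<close>)
  have ev4': "\<forall>\<^sub>F b in at_left \<beta>. 1 < b \<and> b < \<beta>"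
    using eventually_at_left_real[OF \<beta>(2)] by simp
  have "\<forall>\<^sub>F b in at_left \<beta>. (\<forall>k\<in>{..<n}. 0 < orb w b x' k) \<and> (\<forall>k\<in>{..<n}. orb w b x' k < 1) \<and>
      (\<forall>i\<in>{..<n}. \<forall>j\<in>{..<n}. \<pi> (Suc i) < \<pi> (Suc j) \<longrightarrow> orb w b x' i < orb w b x' j) \<and> 1 < b \<and> b < \<beta>"
    by (intro eventually_conj[OF _ eventually_conj[OF _ eventually_conj[OF _ ev4']]]
      eventually_ball_finite finite_lessThan ballI ev1' ev2' ev3') auto
  then obtain b' where b': "\<And>k. k < n \<Longrightarrow> 0 < orb w b' x' k" "\<And>k. k < n \<Longrightarrow> orb w b' x' k < 1"
    "\<And>i j. i < n \<Longrightarrow> j < n \<Longrightarrow> \<pi> (Suc i) < \<pi> (Suc j) \<Longrightarrow> orb w b' x' i < orb w b' x' j"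
    "1 < b'" "b' < \<beta>"
    by (rule exE[OF eventually_happens'[OF trivial_limit_at_left_real]]) blast
  have it: "orb w b' x' k = iter b' k x'" if "k < n" for k
    using b'(1,2) that by (intro orb_eq_iter[of n]) (auto intro: less_imp_le)
  have "is_Pat x' (neg_beta b') n \<pi>"
    by (rule is_PatI[OF perm]) (use b'(3) it in auto)
  moreover have "x' \<in> {0<..1}" using b'(1,2)[of 0] n by simp
  ultimately have "b' \<in> base_set n \<pi>" using base_setI b' n by blast
  then have "\<beta> \<le> b'" using cInf_lower[OF _ bdd_below_base_set, of b' n \<pi>] \<beta> by (simp add: B_minus_eq)
  then show False using b' by simp
qed

section \<open>Orbits through prescribed points\<close>

text \<open>The digits \<open>0, ..., N\<close> force an increasing orbit up to time
  \<open>N\<close>, and a suitable last point gives one more increase. All conditions are open, so a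
  whole interval of starting points works.\<close>

lemma ex_increasing_prefix:
  assumes "1 \<le> N" "real N < b"
  shows "\<exists>u v. 0 < u \<and> u < v \<and> v < 1 \<and> (\<forall>x. u < x \<and> x < v \<longrightarrow> (\<forall>k\<le>N. iter b k x < iter b (Suc k) x))"
proof -
  have b: "b > 1" using assms by linarith
  \<comment> \<open>The right side is the fixed point of the branch with digit \<open>N\<close>.
    Below it the last step increases, and above \<open>real N / b\<close> the image is less than
    1.\<close>
  have "real N / b < (real N + 1) / (b + 1)"
    using assms b by (simp add: field_simps)
  then obtain t where "real N / b < t" "t < (real N + 1) / (b + 1)"
    using dense by blast
  then have t: "real N < b * t" "t * (b + 1) < real N + 1"
    using b by (simp_all add: field_simps)
  have t0: "0 < t" using t(1) b assms by (smt (verit) mult_nonneg_nonpos of_nat_0_le_iff)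
  have t1: "t < 1"
  proof (rule ccontr)
    assume "\<not> t < 1"
    then have "1 * (b + 1) \<le> t * (b + 1)" using b by (intro mult_right_mono) auto
    from le_less_trans[OF this t(2)] show False using assms by simp
  qed
  obtain x where x: "orb int b x N = t" "\<And>k. k \<le> N \<Longrightarrow> 0 < orb int b x k \<and> orb int b x k < 1"
    using ex_orb_endpoint[of b t N int] b t0 t1 assms by fastforce
  have last: "t < orb int b x (Suc N)" "orb int b x (Suc N) < 1"
    using t x(1) by (simp_all add: algebra_simps)
  have unit: "0 < orb int b x k \<and> orb int b x k < 1" if "k < N + 2" for k
  proof (cases "k = Suc N")
    case True
    then show ?thesis using last t0 by auto
  next
    case False
    then show ?thesis using x(2)[of k] that by auto
  qed
  have inc: "orb int b x k < orb int b x (Suc k)" if "k \<le> N" for k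
  proof (cases "k = N")
    case True
    then show ?thesis using last x by simp
  next
    case False
    then have "0 < orb int b x (Suc k)" "orb int b x (Suc (Suc k)) < 1"
      using unit[of "Suc k"] unit[of "Suc (Suc k)"] that by auto
    then have "b * orb int b x k < b * orb int b x (Suc k)" by simp
    then show ?thesis using b by simp
  qed
  have lim: "((\<lambda>s. orb int b s k) \<longlongrightarrow> orb int b x k) (nhds x)" for k
    by (intro tendsto_orb tendsto_const filterlim_ident)
  have "\<forall>\<^sub>F s in nhds x. (\<forall>k\<in>{..<N + 2}. 0 < orb int b s k) \<and> (\<forall>k\<in>{..<N + 2}. orb int b s k < 1) \<and>
      (\<forall>k\<in>{..N}. 0 < orb int b s (Suc k) - orb int b s k)"
    using unit inc by (intro eventually_conj eventually_ball_finite ballI order_tendstoD(1)[OF lim]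
      order_tendstoD(2)[OF lim] order_tendstoD(1)[OF tendsto_diff[OF lim lim]]) auto
  then obtain \<delta> where \<delta>: "\<delta> > 0" "\<And>s. dist s x < \<delta> \<Longrightarrow>
      (\<forall>k\<in>{..<N + 2}. 0 < orb int b s k) \<and> (\<forall>k\<in>{..<N + 2}. orb int b s k < 1) \<and>
      (\<forall>k\<in>{..N}. 0 < orb int b s (Suc k) - orb int b s k)"
    unfolding eventually_nhds_metric by blast
  show ?thesis
  proof (intro exI conjI allI impI)
    show "0 < x" using unit[of 0] by simp
    show "x < x + \<delta> / 2" using \<delta> by simp
    show "x + \<delta> / 2 < 1" using \<delta>(2)[of "x + \<delta> / 2"] \<delta>(1) by (force simp: dist_real_def)
    fix s k assume s: "x < s \<and> s < x + \<delta> / 2" and k: "k \<le> N"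
    then have "dist s x < \<delta>" by (simp add: dist_real_def)
    note P = \<delta>(2)[OF this]
    have it: "orb int b s k = iter b k s" if "k < N + 2" for k
      using P that by (intro orb_eq_iter[of "N + 2"]) (auto intro: less_imp_le)
    have "orb int b s k < orb int b s (Suc k)" using P k by force
    then show "iter b k s < iter b (Suc k) s"
      using it[of k] it[of "Suc k"] k by (simp del: orb.simps funpow.simps)
  qed
qed

text \<open>Every base above \<open>N\<close> admits an increasing orbit of this length. Conversely
  such an orbit forces a digit of at least \<open>N\<close>, hence a base of at least
  \<open>N\<close>.\<close>

lemma B_minus_identity:
  assumes "N \<ge> 2"
  shows "B_minus (N + 2) id = real N"
proof -
  have perm: "id permutes {1..N + 2}" by (rule permutes_id)
  have mem: "b \<in> base_set (N + 2) id" if b: "real N < b" for b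
  proof -
    obtain u v where uv: "0 < u" "u < v" "v < 1"
      "\<And>x. u < x \<Longrightarrow> x < v \<Longrightarrow> \<forall>k\<le>N. iter b k x < iter b (Suc k) x"
      using ex_increasing_prefix[of N b] assms b by auto
    obtain x where x: "u < x" "x < v" using dense[OF uv(2)] by blast
    have step: "iter b k x < iter b (Suc k) x" if "k \<le> N" for k
      using uv(4)[OF x] that by blast
    have mono: "iter b i x < iter b j x" if "i < j" "j < N + 2" for i j
      using that
    proof (induction j)
      case (Suc j)
      then show ?case using step[of j] by (cases "i = j") (auto simp del: funpow.simps intro: less_trans)
    qed simp
    have "is_Pat x (neg_beta b) (N + 2) id"
      by (rule is_PatI[OF perm]) (use mono in auto)
    then show ?thesis using base_setI[of b "N + 2" x id] assms b uv x by force
  qed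
  have ge: "real N \<le> b" if in_set: "b \<in> base_set (N + 2) id" for b
  proof -
    obtain x where x: "b > 1" "x \<in> {0<..1}" "is_Pat x (neg_beta b) (N + 2) id"
      using in_set by (rule base_setE)
    have "iter b k x < iter b (Suc k) x" if "k \<le> N" for k
      using is_Pat_less_iff[OF x(3), of k "Suc k"] that by simp
    then have "int N \<le> \<lfloor>b * iter b N x\<rfloor>"
      using x by (intro floor_increasing_prefix[where N = N]) (auto simp del: funpow.simps)
    moreover have "b * iter b N x \<le> b"
      using iter_in_unit[OF x(2), where b = b and k = N] x by simp
    ultimately show ?thesis by linarith
  qed
  show ?thesis
    unfolding B_minus_eq
  proof (rule antisym)
    show "Inf (base_set (N + 2) id) \<le> real N"
    proof (rule dense_ge)
      show "Inf (base_set (N + 2) id) \<le> b" if "real N < b" for b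
        by (rule cInf_lower[OF mem[OF that] bdd_below_base_set])
    qed
    show "real N \<le> Inf (base_set (N + 2) id)"
    proof (rule cInf_greatest)
      show "base_set (N + 2) id \<noteq> {}" using mem[of "real N + 1"] by auto
    qed (rule ge)
  qed
qed

text \<open>The map jumps exactly where \<open>b * y\<close> is an integer, and there its value is
  1. As long as no point of the interval is sent to 1, the iterates have no jump and remain
  affine.\<close>

lemma iter_affine_before_hit:
  assumes b: "b > 0"
    and no: "\<And>x k. u < x \<Longrightarrow> x < v \<Longrightarrow> 1 \<le> k \<Longrightarrow> k \<le> g \<Longrightarrow> iter b k x \<noteq> 1"
    and "u < x" "x < v" "u < x'" "x' < v"
  shows "iter b g x' - iter b g x = (- b) ^ g * (x' - x)"
  using no assms(3-)
proof (induction g arbitrary: x x')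
  case (Suc g)
  have aff: "iter b g x' - iter b g x = (- b) ^ g * (x' - x)"
    if "u < x" "x < v" "u < x'" "x' < v" for x x'
    using Suc.prems(1) that by (intro Suc.IH) auto
  have le: "\<lfloor>b * iter b g x'\<rfloor> \<le> \<lfloor>b * iter b g x\<rfloor>" if xx: "u < x" "x < v" "u < x'" "x' < v" for x x'
  proof (rule ccontr)
    define y y' f where "y = iter b g x" and "y' = iter b g x'" and "f = \<lfloor>b * iter b g x'\<rfloor>"
    assume "\<not> \<lfloor>b * iter b g x'\<rfloor> \<le> \<lfloor>b * iter b g x\<rfloor>"
    then have "\<lfloor>b * y\<rfloor> < f" by (simp add: y_def f_def)
    then have "b * y < of_int f" "of_int f \<le> b * y'"
      by (simp_all add: floor_less_iff y'_def f_def)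
    then have r: "y < of_int f / b" "of_int f / b \<le> y'"
      using b by (simp_all add: pos_less_divide_eq pos_divide_le_eq mult.commute)
    \<comment> \<open>The affine iterate takes the value \<open>of_int f / b\<close> at the convex
      combination with weight \<open>l\<close>; the next iterate of that point is 1.\<close>
    define l where "l = (of_int f / b - y) / (y' - y)"
    have "y < y'" using r by linarith
    then have l: "0 < l" "l \<le> 1" and ly: "l * (y' - y) = of_int f / b - y"
      using r by (simp_all add: l_def)
    define z where "z = (1 - l) * x + l * x'"
    have z: "u < z" "z < v"
    proof -
      have "(1 - l) * u + l * u < (1 - l) * x + l * x'"
        using l xx by (intro add_le_less_mono mult_left_mono mult_strict_left_mono) auto
      then show "u < z" by (simp add: z_def algebra_simps)
      have "(1 - l) * x + l * x' < (1 - l) * v + l * v"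
        using l xx by (intro add_le_less_mono mult_left_mono mult_strict_left_mono) auto
      then show "z < v" by (simp add: z_def algebra_simps)
    qed
    have "iter b g z - y = (- b) ^ g * (l * (x' - x))"
    proof -
      have "z - x = l * (x' - x)" by (simp add: z_def algebra_simps)
      then show ?thesis using aff[OF xx(1,2) z] by (simp add: y_def)
    qed
    also have "\<dots> = l * (y' - y)"
      using aff[OF xx] by (simp add: y_def y'_def)
    also have "\<dots> = of_int f / b - y" by (rule ly)
    finally have "b * iter b g z = of_int f" using b by simp
    then have "iter b (Suc g) z = 1" by (simp add: neg_beta_def)
    moreover have "iter b (Suc g) z \<noteq> 1" by (rule Suc.prems(1)[OF z]) auto
    ultimately show False by contradiction
  qed
  have "\<lfloor>b * iter b g x'\<rfloor> = \<lfloor>b * iter b g x\<rfloor>"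
    using le[of x x'] le[of x' x] Suc.prems by simp
  then have "iter b (Suc g) x' - iter b (Suc g) x = - b * (iter b g x' - iter b g x)"
    by (simp add: neg_beta_def algebra_simps)
  also have "\<dots> = (- b) ^ Suc g * (x' - x)"
    using aff Suc.prems by simp
  finally show ?case .
qed simp

text \<open>Otherwise all iterates are affine on the interval and would stretch it beyond length
  1.\<close>

lemma ex_iter_eq_1:
  assumes b: "b > 1" and uv: "0 \<le> u" "u < v" "v \<le> 1"
  shows "\<exists>x g. u < x \<and> x < v \<and> 1 \<le> g \<and> iter b g x = 1"
proof (rule ccontr)
  assume no: "\<not> ?thesis"
  obtain x where x: "u < x" "x < v" using dense[OF uv(2)] by blast
  obtain x' where x': "x < x'" "x' < v" using dense[OF x(2)] by blast
  obtain g where g: "1 / (x' - x) < b ^ g" using real_arch_pow[OF b] by blast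
  have "iter b g x' - iter b g x = (- b) ^ g * (x' - x)"
    using no b x x' by (intro iter_affine_before_hit[of b u v]) auto
  then have "\<bar>iter b g x' - iter b g x\<bar> = b ^ g * (x' - x)"
    using b x' by (simp add: abs_mult power_abs)
  moreover have "1 < b ^ g * (x' - x)" using g x' by (simp add: field_simps)
  moreover have "0 < iter b g x" "iter b g x \<le> 1" "0 < iter b g x'" "iter b g x' \<le> 1"
    using iter_in_unit[of x, where b = b and k = g] iter_in_unit[of x', where b = b and k = g] x x' uv
    by auto
  ultimately show False by linarith
qed

text \<open>Let \<open>g\<close> be the first time at which some \<open>x0\<close> of the interval
  hits 1. On one side of \<open>x0\<close> the iterate at time \<open>g\<close> is just below 1, and
  a point on that side hits 1 at a later time.\<close>

lemma ex_iter_near_1_then_1: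
  assumes b: "b > 1" and uv: "0 < u" "u < v" "v < 1" and "\<epsilon> > 0"
  shows "\<exists>x h i. u < x \<and> x < v \<and> h < i \<and> 1 - \<epsilon> < iter b h x \<and> iter b h x < 1 \<and>
    iter b i x = 1 \<and> (\<forall>k<i. iter b k x < 1)"
proof -
  define P where "P g \<longleftrightarrow> 1 \<le> g \<and> (\<exists>x. u < x \<and> x < v \<and> iter b g x = 1)" for g
  define g where "g = (LEAST g. P g)"
  have "\<exists>g. P g" using ex_iter_eq_1[OF b, of u v] uv unfolding P_def by auto
  then have "P g" unfolding g_def by (rule LeastI_ex)
  then obtain g' x0 where g': "g = Suc g'" and x0: "u < x0" "x0 < v" "iter b g x0 = 1"
    unfolding P_def by (cases g) auto
  have no: "iter b k x \<noteq> 1" if "u < x" "x < v" "1 \<le> k" "k < g" for x k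
    using not_less_Least[of k P] that by (auto simp: g_def P_def)
  have aff: "iter b g' x - iter b g' x0 = (- b) ^ g' * (x - x0)" if "u < x" "x < v" for x
    using no b that x0 g' by (intro iter_affine_before_hit[of b u v]) auto
  define f where "f = \<lfloor>b * iter b g' x0\<rfloor>"
  have f: "b * iter b g' x0 = of_int f"
  proof -
    have "neg_beta b (iter b g' x0) = 1" using x0(3) g' by simp
    then show ?thesis unfolding neg_beta_def f_def by linarith
  qed
  \<comment> \<open>The side of \<open>x0\<close> on which \<open>iter b g'\<close> increases: there
    \<open>b * iter b g' x\<close> passes just above the integer \<open>f\<close>, so its image
    falls just below 1.\<close>
  define \<sigma> :: real where "\<sigma> = (- 1) ^ g'"
  have \<sigma>: "\<sigma> = 1 \<or> \<sigma> = - 1" "\<sigma> * \<sigma> = 1"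
    unfolding \<sigma>_def by (cases "even g'") auto
  \<comment> \<open>The entries keep \<open>x\<close> in the interval, the digit at time
    \<open>g'\<close> equal to \<open>f\<close>, and the iterate at time \<open>g\<close> within
    \<open>\<epsilon>\<close> of 1.\<close>
  define \<rho> where "\<rho> = Min {x0 - u, v - x0, 1 / b ^ g, \<epsilon> / b ^ g}"
  have \<rho>: "0 < \<rho>" "\<rho> \<le> x0 - u" "\<rho> \<le> v - x0" "\<rho> \<le> 1 / b ^ g" "\<rho> \<le> \<epsilon> / b ^ g"
    using x0 b \<open>\<epsilon> > 0\<close> by (auto simp: \<rho>_def)
  have near: "iter b g x = 1 - b ^ g * (\<sigma> * (x - x0)) \<and> u < x \<and> x < v"
    if x: "0 < \<sigma> * (x - x0)" "\<sigma> * (x - x0) < \<rho>" for x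
  proof -
    define r where "r = \<sigma> * (x - x0)"
    have xr: "x - x0 = \<sigma> * r" using \<sigma>(2) by (simp add: r_def flip: mult.assoc)
    have "\<bar>x - x0\<bar> < \<rho>" using x \<sigma>(1) by (auto simp: r_def)
    then have in_uv: "u < x" "x < v" using \<rho> by auto
    have "(- b) ^ g' * (x - x0) = b ^ g' * (\<sigma> * \<sigma>) * r"
      unfolding xr \<sigma>_def by (simp flip: power_mult_distrib)
    then have "iter b g' x = iter b g' x0 + b ^ g' * r"
      using aff[OF in_uv] \<sigma>(2) by simp
    then have *: "b * iter b g' x = of_int f + b ^ g * r"
      using f by (simp add: g' algebra_simps)
    have "0 < b ^ g * r" using x b by (simp add: r_def)
    moreover have "b ^ g * r < 1"
    proof -
      have "r < 1 / b ^ g" using x \<rho> by (simp add: r_def)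
      then show ?thesis using b by (simp add: field_simps)
    qed
    ultimately have "\<lfloor>b * iter b g' x\<rfloor> = f" using * by linarith
    then show ?thesis using * in_uv by (simp add: g' neg_beta_def r_def)
  qed
  define u' v' where "u' = min x0 (x0 + \<sigma> * \<rho>)" and "v' = max x0 (x0 + \<sigma> * \<rho>)"
  have in': "0 < \<sigma> * (x - x0) \<and> \<sigma> * (x - x0) < \<rho>" if "u' < x" "x < v'" for x
    using that \<sigma>(1) \<rho>(1) by (auto simp: u'_def v'_def)
  have "0 \<le> u'" "u' < v'" "v' \<le> 1"
    using \<sigma>(1) \<rho> uv x0 by (auto simp: u'_def v'_def)
  then obtain x i0 where x: "u' < x" "x < v'" "1 \<le> i0" "iter b i0 x = 1"
    using ex_iter_eq_1[OF b] by blast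
  define i where "i = (LEAST i. iter b i x = 1)"
  have i: "iter b i x = 1" unfolding i_def using x(4) by (rule LeastI)
  note nx = near[OF conjunct1[OF in'[OF x(1,2)]] conjunct2[OF in'[OF x(1,2)]]]
  have le1: "iter b k x \<le> 1" for k
    using iter_in_unit[of x, where b = b and k = k] nx uv by auto
  have *: "0 < b ^ g * (\<sigma> * (x - x0))" using in'[OF x(1,2)] b by simp
  have "g < i"
  proof (rule ccontr)
    assume "\<not> g < i"
    moreover have "i \<noteq> g" using i nx * b by auto
    moreover have "i \<noteq> 0" using i nx uv by (cases i) auto
    ultimately show False using no[of x i] i nx by simp
  qed
  moreover have "iter b k x < 1" if "k < i" for k
    using not_less_Least[of k "\<lambda>i. iter b i x = 1"] that le1[of k] by (simp add: i_def less_le)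
  moreover have "b ^ g * (\<sigma> * (x - x0)) < \<epsilon>"
  proof -
    have "\<sigma> * (x - x0) < \<epsilon> / b ^ g" using in'[OF x(1,2)] \<rho> by simp
    then show ?thesis using b by (simp add: field_simps)
  qed
  ultimately show ?thesis
    using i nx * by (intro exI[of _ x] exI[of _ g] exI[of _ i]) auto
qed

text \<open>Continuity suffices except where the orbit of 1 is at 1 and might be overshot. Up to
  time \<open>K\<close> this occurs at time 0, and at time \<open>K\<close> if the orbit is purely
  periodic; an even exponent keeps the orbit below 1.\<close>

lemma orb_near_1:
  assumes b: "b > 1" and K: "m < K" "iter b K 1 = iter b m 1" "inj_on (\<lambda>k. iter b k 1) {..<K}"
    and not_odd: "\<not> (m = 0 \<and> odd K)" and "e > 0"
  shows "\<exists>\<epsilon>>0. \<forall>s. 1 - \<epsilon> < s \<and> s < 1 \<longrightarrow> (\<forall>k<K. \<bar>iter b k s - iter b k 1\<bar> < e \<and>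
      \<lfloor>b * iter b k s\<rfloor> = \<lfloor>b * iter b k 1\<rfloor>)"
proof -
  define a where "a k = \<lfloor>b * iter b k 1\<rfloor>" for k
  have orb1: "orb a b 1 k = iter b k 1" for k
    unfolding a_def by (rule iter_eq_orb[symmetric])
  have c01: "0 < iter b k 1 \<and> iter b k 1 \<le> 1" for k
    using iter_in_unit[of 1, where b = b and k = k] by simp
  have lim: "((\<lambda>s. orb a b s k) \<longlongrightarrow> iter b k 1) (at_left 1)" for k
    unfolding orb1[symmetric] by (intro tendsto_orb tendsto_intros)
  have lt1: "\<forall>\<^sub>F s in at_left (1::real). s < 1"
    using eventually_at_left_real[of 0 1] by (auto elim: eventually_mono)
  have ev1: "\<forall>\<^sub>F s in at_left 1. orb a b s k \<le> 1" if "k \<le> K" for k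
  proof (cases "iter b k 1 < 1")
    case True
    then show ?thesis by (intro eventually_mono[OF order_tendstoD(2)[OF lim]]) auto
  next
    case False
    then have one: "iter b k 1 = 1" using c01[of k] by simp
    have ev: "even k"
    proof (cases "k = K")
      case True
      then have "iter b m 1 = iter b 0 1" using one K by simp
      then have "m = 0" using inj_onD[OF K(3), of m 0] K(1) by simp
      then show ?thesis using not_odd True by simp
    next
      case False
      then show ?thesis using inj_onD[OF K(3), of k 0] K(1) that one by simp
    qed
    show ?thesis using lt1
    proof eventually_elim
      fix s :: real assume "s < 1"
      have "orb a b s k - 1 = (- b) ^ k * (s - 1)"
        using orb_diff[of a b s k 1] orb1[of k] one by simp
      also have "\<dots> \<le> 0" using ev \<open>s < 1\<close> by (intro mult_nonneg_nonpos zero_le_even_power) auto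
      finally show "orb a b s k \<le> 1" by simp
    qed
  qed
  have ev2: "\<forall>\<^sub>F s in at_left 1. 0 < orb a b s k" for k
    using c01[of k] by (intro order_tendstoD(1)[OF lim]) auto
  have ev3: "\<forall>\<^sub>F s in at_left 1. \<bar>orb a b s k - iter b k 1\<bar> < e" for k
    using tendstoD[OF lim \<open>e > 0\<close>] by (simp add: dist_real_def)
  have "\<forall>\<^sub>F s in at_left 1. (\<forall>k\<in>{..K}. orb a b s k \<le> 1) \<and> (\<forall>k\<in>{..K}. 0 < orb a b s k) \<and>
      (\<forall>k\<in>{..K}. \<bar>orb a b s k - iter b k 1\<bar> < e)"
    by (intro eventually_conj eventually_ball_finite finite_atMost ballI ev1 ev2 ev3) auto
  then obtain l where l: "l < 1" "\<And>s. l < s \<Longrightarrow> s < 1 \<Longrightarrow> (\<forall>k\<in>{..K}. orb a b s k \<le> 1) \<and>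
      (\<forall>k\<in>{..K}. 0 < orb a b s k) \<and> (\<forall>k\<in>{..K}. \<bar>orb a b s k - iter b k 1\<bar> < e)"
    unfolding eventually_at_left_field by blast
  show ?thesis
  proof (intro exI[of _ "1 - l"] conjI allI impI)
    show "0 < 1 - l" using l by simp
    fix s k assume s: "1 - (1 - l) < s \<and> s < 1" and k: "k < K"
    have P: "(\<forall>k\<in>{..K}. orb a b s k \<le> 1) \<and>
      (\<forall>k\<in>{..K}. 0 < orb a b s k) \<and> (\<forall>k\<in>{..K}. \<bar>orb a b s k - iter b k 1\<bar> < e)"
      by (rule l(2)) (use s in auto)
    have it: "orb a b s k = iter b k s" if "k \<le> K" for k
      using P that by (intro orb_eq_iter[of "Suc K"]) auto
    have "\<bar>orb a b s k - iter b k 1\<bar> < e" using P k by simp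
    then show "\<bar>iter b k s - iter b k 1\<bar> < e" unfolding it[OF less_imp_le[OF k]] .
    have "0 < orb a b s (Suc k)" "orb a b s (Suc k) \<le> 1"
      using P k by (auto simp del: orb.simps)
    then have "\<lfloor>b * orb a b s k\<rfloor> = a k" by (rule orb_digit)
    then show "\<lfloor>b * iter b k s\<rfloor> = \<lfloor>b * iter b k 1\<rfloor>" using it[of k] k by (simp add: a_def)
  qed
qed

section \<open>Yrrap numbers are bases of patterns\<close>

text \<open>In the assumption \<open>side\<close>: time \<open>h\<close> is a visit slightly to the left of \<open>1\<close>, except when \<open>1\<close> is
  purely periodic with odd period, where no point to the left of \<open>1\<close> follows \<open>1\<close> for a whole period.
  Then the second visit to \<open>1\<close> takes over: in base slightly above \<open>\<beta>\<close> an odd period reverses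
  the order, so a start above \<open>\<zeta> b\<close> returns below \<open>\<zeta> b\<close>.\<close>

locale yrrap_orbit =
  fixes \<beta> x :: real and N m K i h :: nat
  assumes \<beta>: "\<beta> > 1" "real N < \<beta>" "\<beta> < real N + 1"
    and K: "m < K" "iter \<beta> K 1 = iter \<beta> m 1" "inj_on (\<lambda>k. iter \<beta> k 1) {..<K}"
    and x: "x \<in> {0<..1}"
    and prefix: "\<And>k. k \<le> N \<Longrightarrow> iter \<beta> k x < iter \<beta> (Suc k) x"
    and hit: "iter \<beta> i x = 1" "\<And>k. k < i \<Longrightarrow> iter \<beta> k x < 1"
    and follow: "\<And>k. k < K \<Longrightarrow> \<lfloor>\<beta> * iter \<beta> (h + k) x\<rfloor> = \<lfloor>\<beta> * iter \<beta> k 1\<rfloor>"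
    and close: "\<And>j k. j < K \<Longrightarrow> k < K \<Longrightarrow> iter \<beta> j 1 < iter \<beta> k 1 \<Longrightarrow>
      iter \<beta> (h + j) x < iter \<beta> k 1 \<and> iter \<beta> j 1 < iter \<beta> (h + k) x \<and> iter \<beta> (h + j) x < iter \<beta> (h + k) x"
    and side: "h < i \<or> m = 0 \<and> odd K \<and> h = i + K"
begin

definition c where "c k = iter \<beta> k 1"
definition a where "a k = \<lfloor>\<beta> * c k\<rfloor>"
definition d where "d k = \<lfloor>\<beta> * iter \<beta> k x\<rfloor>"
text \<open>Long enough to contain the \<open>K\<close> points following each of the times
  \<open>i\<close> and \<open>h\<close>.\<close>

definition n where "n = max i h + K + 1"
text \<open>The substitute for 1 in base \<open>b\<close>: started here, the digits of the expansion
  of 1 in base \<open>\<beta>\<close> still give an eventually periodic orbit.\<close>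

definition \<zeta> where "\<zeta> b = periodic_start a m K b"
definition z where "z b k = orb a b (\<zeta> b) k"
text \<open>Orbits with the digits \<open>d\<close> are parametrized by their position
  \<open>s\<close> at time \<open>i\<close>.\<close>

definition start where "start b s = (s - orb d b 0 i) / (- b) ^ i"
definition Y where "Y b s k = orb d b (start b s) k"

lemma c_Suc: "c (Suc k) = of_int (a k) + 1 - \<beta> * c k"
  by (simp add: c_def a_def neg_beta_def)

lemma c_0: "c 0 = 1"
  by (simp add: c_def)

lemma c_unit: "0 < c k" "c k \<le> 1"
  using iter_in_unit[of 1, where b = \<beta> and k = k] by (auto simp: c_def)

lemma c_inj: "j < K \<Longrightarrow> k < K \<Longrightarrow> c j = c k \<Longrightarrow> j = k"
  using K(3) by (auto simp: c_def dest: inj_onD)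

lemma orb_c: "orb a \<beta> 1 k = c k"
  unfolding a_def[abs_def] c_def by (rule iter_eq_orb[symmetric])

lemma c_det: "c j = c k \<Longrightarrow> c (Suc j) = c (Suc k) \<and> a j = a k"
  by (simp add: c_Suc a_def)

lemma orb_x: "orb d \<beta> x k = iter \<beta> k x"
  unfolding d_def[abs_def] by (rule iter_eq_orb[symmetric])

lemma iter_x_add: "iter \<beta> (i + k) x = c k"
  using iter_add[where b = \<beta> and i = i and k = k and x = x] hit(1) by (simp only: c_def)

lemma d_i: "d (i + k) = a k"
  by (simp only: d_def iter_x_add a_def)

lemma d_h: "k < K \<Longrightarrow> d (h + k) = a k"
  using follow by (simp only: d_def a_def c_def)

lemma zeta_beta: "\<zeta> \<beta> = 1"
  unfolding \<zeta>_def using \<beta> K by (intro periodic_start_eqI) (auto simp: orb_c c_def)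

lemma z_return: "b > 1 \<Longrightarrow> z b K = z b m"
  unfolding z_def \<zeta>_def using K by (intro orb_periodic_start)

lemma z_0: "z b 0 = \<zeta> b"
  by (simp add: z_def)

lemma z_Suc: "z b (Suc k) = of_int (a k) + 1 - b * z b k"
  by (simp add: z_def)

lemma z_collapse:
  assumes "b > 1" "c j = c k"
  shows "z b j = z b k"
  unfolding z_def
proof (rule orb_collapse[OF c_det K(1) _ _ _ assms(2)])
  show "c K = c m" using K(2) by (simp only: c_def)
  show "inj_on c {..<K}" using K(3) by (simp only: c_def[abs_def])
  show "orb a b (\<zeta> b) K = orb a b (\<zeta> b) m" using z_return[OF assms(1)] by (simp only: z_def)
qed

lemma Y_i: "b \<noteq> 0 \<Longrightarrow> Y b s i = s"
  using orb_diff[of d b "start b s" i 0] by (simp add: Y_def start_def)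

lemma Y_add_i: "b \<noteq> 0 \<Longrightarrow> Y b s (i + k) = orb a b s k"
  using Y_i[of b s] by (simp add: Y_def orb_add d_i)

lemma Y_add_h: "k \<le> K \<Longrightarrow> Y b s (h + k) = orb a b (Y b s h) k"
  unfolding Y_def orb_add by (intro orb_cong) (auto simp: d_h)

lemma Y_zeta: "b > 1 \<Longrightarrow> Y b (\<zeta> b) (i + k) = z b k"
  by (simp add: Y_add_i z_def)

lemma start_beta: "start \<beta> 1 = x"
  using orb_diff[of d \<beta> x i 0] hit(1) \<beta> by (simp add: start_def orb_x)

lemma Y_beta: "Y \<beta> 1 k = iter \<beta> k x"
  by (simp add: Y_def start_beta orb_x)

lemma tendsto_Y:
  assumes "b > 1" "(f \<longlongrightarrow> b) F" "(g \<longlongrightarrow> s) F"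
  shows "((\<lambda>t. Y (f t) (g t) k) \<longlongrightarrow> Y b s k) F"
  unfolding Y_def start_def using assms by (intro tendsto_orb tendsto_intros) auto

lemma tendsto_zeta: "b > 1 \<Longrightarrow> (f \<longlongrightarrow> b) F \<Longrightarrow> ((\<lambda>t. \<zeta> (f t)) \<longlongrightarrow> \<zeta> b) F"
  unfolding \<zeta>_def using K(1) by (intro tendsto_periodic_start)

lemma Y_diff: "Y b s k - Y b t k = (- b) ^ k * (start b s - start b t)"
  unfolding Y_def by (rule orb_diff)

text \<open>The distinct points of the two orbits form finite systems with the same digits, order
  and successor map, where \<open>f\<close> leads back to \<open>m\<close>. Applying
  \<open>expansion_le\<close> in either direction gives the two claims.\<close>

lemma base_compare:
  assumes b: "b > 1" and ord: "\<And>j k. j < K \<Longrightarrow> k < K \<Longrightarrow> c j < c k \<Longrightarrow> z b j < z b k"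
    and pos: "\<And>k. k < K \<Longrightarrow> 0 < z b k"
  shows "\<zeta> b \<le> 1 \<Longrightarrow> \<beta> \<le> b" and "1 \<le> \<zeta> b \<Longrightarrow> b \<le> \<beta>"
proof -
  define f where "f k = (if Suc k < K then Suc k else m)" for k
  have f: "f k < K" for k using K(1) by (simp add: f_def)
  have f_K: "Suc k = K" if "k < K" "\<not> Suc k < K" for k using that by simp
  have cf: "c (f k) = c (Suc k)" and zf: "z b (f k) = z b (Suc k)" if "k < K" for k
    using K(2) z_return[OF b] f_K[OF that] by (auto simp: f_def c_def)
  have iff: "c j < c k \<longleftrightarrow> z b j < z b k" if "j < K" "k < K" for j k
    using ord[OF that] ord[OF that(2,1)] c_inj[OF that]
    by (cases "c j" "c k" rule: linorder_cases) auto
  have c_eq: "\<beta> * c k = a k + 1 - c (f k)" and z_eq: "b * z b k = a k + 1 - z b (f k)" if "k < K" for k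
    by (simp_all add: cf[OF that] zf[OF that] c_Suc z_Suc)
  have a0: "0 \<le> a k" for k using c_unit[of k] \<beta> by (simp add: a_def)
  have a1: "a j \<le> a k" if "c j < c k" for j k
    unfolding a_def using that \<beta> by (intro floor_mono) simp
  have a2: "a j < a k" if "j < K" "k < K" "c j < c k" "c (f j) < c (f k)" for j k
  proof -
    have "neg_beta \<beta> (c j) < neg_beta \<beta> (c k)"
      using that cf by (simp add: c_def)
    then show ?thesis unfolding a_def using \<beta> that by (intro floor_less_of_neg_beta_le) auto
  qed
  have c_top: "c k \<le> c 0" for k using c_unit by (simp add: c_0)
  have z_top: "z b k \<le> z b 0" if "k < K" for k
    using iff[of 0 k] K(1) that c_top[of k] by (simp add: not_less[symmetric])
  have K0: "0 < K" using K(1) by simp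
  show "\<beta> \<le> b" if "\<zeta> b \<le> 1"
    by (rule expansion_le[of K f \<beta> c a b "z b"])
      (use K0 f c_eq z_eq c_unit pos iff c_top a0 a1 a2 that in \<open>auto simp: z_0 c_0\<close>)
  show "b \<le> \<beta>" if "1 \<le> \<zeta> b"
    by (rule expansion_le[of K f b "z b" a \<beta> c])
      (use K0 f c_eq z_eq c_unit pos iff z_top a0 a1 a2 that in \<open>auto simp: z_0 c_0\<close>)
qed

section \<open>Realizations in bases slightly above \<open>\<beta>\<close>\<close>

lemma tendsto_Y_zeta: "((\<lambda>b. Y b (\<zeta> b) k) \<longlongrightarrow> iter \<beta> k x) (at_right \<beta>)"
proof -
  have "((\<lambda>b. Y b (\<zeta> b) k) \<longlongrightarrow> Y \<beta> (\<zeta> \<beta>) k) (at_right \<beta>)"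
    using \<beta>(1) by (intro tendsto_Y tendsto_zeta tendsto_ident_at)
  then show ?thesis by (simp add: zeta_beta Y_beta)
qed

lemma tendsto_z: "((\<lambda>b. z b k) \<longlongrightarrow> c k) (at_right \<beta>)"
proof -
  have "((\<lambda>b. z b k) \<longlongrightarrow> orb a \<beta> (\<zeta> \<beta>) k) (at_right \<beta>)"
    unfolding z_def using \<beta>(1) by (intro tendsto_orb tendsto_zeta tendsto_ident_at)
  then show ?thesis by (simp add: zeta_beta orb_c)
qed

lemma eventually_greater: "\<forall>\<^sub>F b in at_right \<beta>. \<beta> < b"
  by (rule eventually_at_right_less)

text \<open>Near \<open>\<beta>\<close> the formal orbit is ordered as in base
  \<open>\<beta>\<close>, so \<open>1 \<le> \<zeta> b\<close> would force
  \<open>b \<le> \<beta>\<close>.\<close>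

lemma eventually_zeta_less: "\<forall>\<^sub>F b in at_right \<beta>. \<zeta> b < 1"
proof -
  have ord: "\<forall>\<^sub>F b in at_right \<beta>. c j < c k \<longrightarrow> 0 < z b k - z b j" for j k
  proof (cases "c j < c k")
    case True
    then have "\<forall>\<^sub>F b in at_right \<beta>. 0 < z b k - z b j"
      by (intro order_tendstoD(1)[OF tendsto_diff[OF tendsto_z tendsto_z]]) simp
    then show ?thesis by eventually_elim simp
  qed simp
  have "\<forall>\<^sub>F b in at_right \<beta>. (\<forall>j\<in>{..<K}. \<forall>k\<in>{..<K}. c j < c k \<longrightarrow> 0 < z b k - z b j) \<and>
      (\<forall>k\<in>{..<K}. 0 < z b k) \<and> \<beta> < b"
    using c_unit by (intro eventually_conj eventually_ball_finite ballI ord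
      order_tendstoD(1)[OF tendsto_z] eventually_greater) auto
  then show ?thesis
  proof eventually_elim
    fix b assume b: "(\<forall>j\<in>{..<K}. \<forall>k\<in>{..<K}. c j < c k \<longrightarrow> 0 < z b k - z b j) \<and>
      (\<forall>k\<in>{..<K}. 0 < z b k) \<and> \<beta> < b"
    show "\<zeta> b < 1"
    proof (rule ccontr)
      assume "\<not> \<zeta> b < 1"
      then have "b \<le> \<beta>" using b \<beta>(1) by (intro base_compare(2)) auto
      then show False using b by simp
    qed
  qed
qed

text \<open>The features the pattern has to capture: the prefix that determines the digits, the
  order of the orbit of 1 across both visits, and the bracketing of \<open>\<zeta> b\<close> by the
  visits at \<open>h\<close> and \<open>i\<close>. The bounds and the distinctness make the pattern
  exist.\<close>

definition good where
  "good b s \<longleftrightarrow> (\<forall>k\<in>{..<n}. 0 < Y b s k \<and> Y b s k < 1) \<and>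
    (\<forall>k\<in>{..N}. Y b s k < Y b s (Suc k)) \<and>
    (\<forall>j\<in>{..<K}. \<forall>k\<in>{..<K}. c j < c k \<longrightarrow> Y b s (i + j) < Y b s (i + k) \<and> Y b s (i + j) < Y b s (h + k) \<and>
      Y b s (h + j) < Y b s (i + k) \<and> Y b s (h + j) < Y b s (h + k)) \<and>
    Y b s h < \<zeta> b \<and> \<zeta> b < Y b s i \<and>
    (\<forall>k\<in>{..<n}. \<forall>j\<in>{..<k}. Y b s j \<noteq> Y b s k)"

lemma N_less_i: "N < i"
proof (rule ccontr)
  assume "\<not> N < i"
  then have "1 < iter \<beta> (Suc i) x" using prefix[of i] hit(1) by simp
  then show False using iter_in_unit[OF x, where b = \<beta> and k = "Suc i"] by simp
qed

text \<open>Continuity fails only where the orbit of \<open>x\<close> is at 1. There the formal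
  orbit sits at \<open>\<zeta> b\<close>, which is less than 1.\<close>

lemma eventually_Y_unit:
  assumes "k < n"
  shows "\<forall>\<^sub>F b in at_right \<beta>. 0 < Y b (\<zeta> b) k \<and> Y b (\<zeta> b) k < 1"
proof (rule eventually_conj)
  have unit: "0 < iter \<beta> k x" "iter \<beta> k x \<le> 1"
    using iter_in_unit[OF x, where b = \<beta> and k = k] by auto
  show "\<forall>\<^sub>F b in at_right \<beta>. 0 < Y b (\<zeta> b) k"
    using unit by (intro order_tendstoD(1)[OF tendsto_Y_zeta])
  show "\<forall>\<^sub>F b in at_right \<beta>. Y b (\<zeta> b) k < 1"
  proof (cases "iter \<beta> k x < 1")
    case True
    then show ?thesis by (intro order_tendstoD(2)[OF tendsto_Y_zeta])
  next
    case False
    then have one: "iter \<beta> k x = 1" using unit by simp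
    then have "i \<le> k" using hit(2)[of k] by (force simp: not_less[symmetric])
    then obtain l where l: "k = i + l" using le_Suc_ex by blast
    then have "c l = c 0" using one iter_x_add[of l] by (simp only: c_0)
    show ?thesis
      using eventually_zeta_less eventually_greater
    proof eventually_elim
      case (elim b)
      then have b: "b > 1" using \<beta>(1) by simp
      have "Y b (\<zeta> b) k = \<zeta> b"
        unfolding l Y_zeta[OF b] z_collapse[OF b \<open>c l = c 0\<close>] by (rule z_0)
      then show ?case using elim by simp
    qed
  qed
qed

lemma eventually_Y_less:
  assumes "iter \<beta> j x < iter \<beta> k x"
  shows "\<forall>\<^sub>F b in at_right \<beta>. Y b (\<zeta> b) j < Y b (\<zeta> b) k"
proof -
  have "\<forall>\<^sub>F b in at_right \<beta>. 0 < Y b (\<zeta> b) k - Y b (\<zeta> b) j"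
    by (intro order_tendstoD(1)[OF tendsto_diff[OF tendsto_Y_zeta tendsto_Y_zeta]]) (use assms in simp)
  then show ?thesis by eventually_elim simp
qed

text \<open>First \<open>b\<close> tends to \<open>\<beta>\<close> with
  \<open>s = \<zeta> b\<close>, which yields all strict relations that hold in base
  \<open>\<beta>\<close>. Then \<open>s\<close> moves slightly above \<open>\<zeta> b\<close>, which
  brackets \<open>\<zeta> b\<close> and removes coincidences.\<close>

lemma eventually_good: "\<forall>\<^sub>F b in at_right \<beta>. \<forall>\<^sub>F s in at_right (\<zeta> b). good b s"
proof -
  have P2: "\<forall>\<^sub>F b in at_right \<beta>. Y b (\<zeta> b) k < Y b (\<zeta> b) (Suc k)" if "k \<le> N" for k
    by (intro eventually_Y_less prefix that)
  have P3: "\<forall>\<^sub>F b in at_right \<beta>. c j < c k \<longrightarrow> Y b (\<zeta> b) (i + j) < Y b (\<zeta> b) (i + k) \<and>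
      Y b (\<zeta> b) (i + j) < Y b (\<zeta> b) (h + k) \<and> Y b (\<zeta> b) (h + j) < Y b (\<zeta> b) (i + k) \<and>
      Y b (\<zeta> b) (h + j) < Y b (\<zeta> b) (h + k)" if "j < K" "k < K" for j k
  proof (cases "c j < c k")
    case True
    have "\<forall>\<^sub>F b in at_right \<beta>. Y b (\<zeta> b) (i + j) < Y b (\<zeta> b) (i + k) \<and>
      Y b (\<zeta> b) (i + j) < Y b (\<zeta> b) (h + k) \<and> Y b (\<zeta> b) (h + j) < Y b (\<zeta> b) (i + k) \<and>
      Y b (\<zeta> b) (h + j) < Y b (\<zeta> b) (h + k)"
      using close[OF that] True unfolding c_def[symmetric]
      by (intro eventually_conj eventually_Y_less) (simp_all only: iter_x_add)
    then show ?thesis by eventually_elim simp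
  qed simp
  have P4: "\<forall>\<^sub>F b in at_right \<beta>. h < i \<longrightarrow> Y b (\<zeta> b) h < \<zeta> b"
  proof (cases "h < i")
    case True
    have "((\<lambda>b. \<zeta> b - Y b (\<zeta> b) h) \<longlongrightarrow> \<zeta> \<beta> - iter \<beta> h x) (at_right \<beta>)"
      using \<beta>(1) by (intro tendsto_diff tendsto_Y_zeta tendsto_zeta tendsto_ident_at)
    then have "\<forall>\<^sub>F b in at_right \<beta>. 0 < \<zeta> b - Y b (\<zeta> b) h"
      by (rule order_tendstoD) (use hit(2)[OF True] in \<open>simp add: zeta_beta\<close>)
    then show ?thesis by eventually_elim simp
  qed simp
  have "\<forall>\<^sub>F b in at_right \<beta>. \<beta> < b \<and> (\<forall>k\<in>{..<n}. 0 < Y b (\<zeta> b) k \<and> Y b (\<zeta> b) k < 1) \<and>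
    (\<forall>k\<in>{..N}. Y b (\<zeta> b) k < Y b (\<zeta> b) (Suc k)) \<and>
    (\<forall>j\<in>{..<K}. \<forall>k\<in>{..<K}. c j < c k \<longrightarrow> Y b (\<zeta> b) (i + j) < Y b (\<zeta> b) (i + k) \<and>
      Y b (\<zeta> b) (i + j) < Y b (\<zeta> b) (h + k) \<and> Y b (\<zeta> b) (h + j) < Y b (\<zeta> b) (i + k) \<and>
      Y b (\<zeta> b) (h + j) < Y b (\<zeta> b) (h + k)) \<and> (h < i \<longrightarrow> Y b (\<zeta> b) h < \<zeta> b)"
    by (intro eventually_conj eventually_greater P4 eventually_ball_finite ballI eventually_Y_unit P2 P3)
      simp_all
  then show ?thesis
  proof eventually_elim
    case (elim b)
    then have b: "b > 1" using \<beta>(1) by simp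
    let ?F = "at_right (\<zeta> b)"
    have lim: "((\<lambda>s. Y b s k) \<longlongrightarrow> Y b (\<zeta> b) k) ?F" for k
      by (intro tendsto_Y b tendsto_const tendsto_ident_at)
    have less: "\<forall>\<^sub>F s in ?F. Y b s j < Y b s k" if "Y b (\<zeta> b) j < Y b (\<zeta> b) k" for j k
    proof -
      have "\<forall>\<^sub>F s in ?F. 0 < Y b s k - Y b s j"
        by (intro order_tendstoD(1)[OF tendsto_diff[OF lim lim]]) (use that in simp)
      then show ?thesis by eventually_elim simp
    qed
    have gt: "\<forall>\<^sub>F s in ?F. \<zeta> b < s" by (rule eventually_at_right_less)
    have Q1: "\<forall>\<^sub>F s in ?F. 0 < Y b s k \<and> Y b s k < 1" if "k < n" for k
      using elim that by (intro eventually_conj order_tendstoD(1)[OF lim] order_tendstoD(2)[OF lim]) auto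
    have Q2: "\<forall>\<^sub>F s in ?F. Y b s k < Y b s (Suc k)" if "k \<le> N" for k
      using elim that by (intro less) auto
    have Q3: "\<forall>\<^sub>F s in ?F. c j < c k \<longrightarrow> Y b s (i + j) < Y b s (i + k) \<and> Y b s (i + j) < Y b s (h + k) \<and>
      Y b s (h + j) < Y b s (i + k) \<and> Y b s (h + j) < Y b s (h + k)" if "j < K" "k < K" for j k
    proof (cases "c j < c k")
      case True
      have "\<forall>\<^sub>F s in ?F. Y b s (i + j) < Y b s (i + k) \<and> Y b s (i + j) < Y b s (h + k) \<and>
        Y b s (h + j) < Y b s (i + k) \<and> Y b s (h + j) < Y b s (h + k)"
        using elim that True by (intro eventually_conj less) blast+
      then show ?thesis by eventually_elim simp
    qed simp
    have Q4: "\<forall>\<^sub>F s in ?F. Y b s h < \<zeta> b"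
      using side
    proof (elim disjE conjE)
      assume "h < i"
      then show ?thesis using elim by (intro order_tendstoD(2)[OF lim]) auto
    next
      assume h: "m = 0" "odd K" "h = i + K"
      show ?thesis using gt
      proof eventually_elim
        case (elim s)
        have "z b m = z b 0" by (rule arg_cong[OF h(1)])
        then have z: "orb a b (\<zeta> b) K = \<zeta> b" using z_return[OF b] by (simp add: z_def)
        have "Y b s h - \<zeta> b = orb a b s K - orb a b (\<zeta> b) K"
          using b Y_add_i[of b s K] by (simp only: h(3) z)
        also have "\<dots> = (- b) ^ K * (s - \<zeta> b)" by (rule orb_diff)
        also have "\<dots> < 0" using h(2) elim b by (intro mult_neg_pos) (simp_all add: power_less_zero_eq)
        finally show ?case by simp
      qed
    qed
    have Q5: "\<forall>\<^sub>F s in ?F. \<zeta> b < Y b s i"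
      using gt by eventually_elim (use b in \<open>simp add: Y_i\<close>)
    \<comment> \<open>The two points are affine in \<open>s\<close> with different slopes, so they
      coincide for at most one \<open>s\<close>.\<close>
    have Q6: "\<forall>\<^sub>F s in ?F. Y b s j \<noteq> Y b s k" if "j < k" for j k
    proof (cases "\<exists>t. Y b t j = Y b t k")
      case True
      then obtain t where t: "Y b t j = Y b t k" by blast
      have "\<forall>\<^sub>F s in ?F. s \<noteq> t" by (rule eventually_neq_at_within)
      then show ?thesis
      proof eventually_elim
        case (elim s)
        then have "start b s - start b t \<noteq> 0" using b by (simp add: start_def)
        moreover have "Y b s k - Y b s j = ((- b) ^ k - (- b) ^ j) * (start b s - start b t)"
          using Y_diff[of b s k t] Y_diff[of b s j t] t by (simp add: left_diff_distrib)
        moreover have "(- b) ^ k - (- b) ^ j \<noteq> 0" using pow_diff_ne[OF b, of j k] that by simp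
        ultimately show ?case by auto
      qed
    qed simp
    show ?case
      unfolding good_def
      by (intro eventually_conj eventually_ball_finite ballI Q1 Q2 Q3 Q4 Q5 Q6) simp_all
  qed
qed

lemma good_realization:
  assumes "b > 1" "good b s"
  shows "start b s \<in> {0<..1}" and "k < n \<Longrightarrow> iter b k (start b s) = Y b s k"
    and "\<exists>\<pi>. is_Pat (start b s) (neg_beta b) n \<pi>"
proof -
  have unit: "0 < Y b s k" "Y b s k < 1" if "k < n" for k
    using assms(2) that by (auto simp: good_def)
  have it: "iter b k (start b s) = Y b s k" if "k < n" for k
    using unit[unfolded Y_def] that unfolding Y_def
    by (intro orb_eq_iter[symmetric, of n]) (auto intro: less_imp_le)
  then show "k < n \<Longrightarrow> iter b k (start b s) = Y b s k" .
  show "start b s \<in> {0<..1}" using unit[of 0] by (simp add: Y_def n_def)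
  have "inj_on (\<lambda>k. iter b k (start b s)) {..<n}"
  proof (rule linorder_inj_onI)
    fix j k assume jk: "j < k" "j \<in> {..<n}" "k \<in> {..<n}"
    then have "Y b s j \<noteq> Y b s k" using assms(2) by (auto simp: good_def)
    then show "iter b j (start b s) \<noteq> iter b k (start b s)" using it jk by simp
  qed auto
  then show "\<exists>\<pi>. is_Pat (start b s) (neg_beta b) n \<pi>" by (rule ex_is_Pat)
qed

text \<open>In a smaller base \<open>b'\<close> the pattern forces the digits \<open>d\<close>. Its
  points after the times \<open>i\<close> and \<open>h\<close> then enclose the formal orbit from
  \<open>\<zeta> b'\<close>, which inherits the order of \<open>c\<close>, and
  \<open>base_compare\<close> contradicts \<open>b' < \<beta>\<close>.\<close>

lemma good_lower_bound:
  assumes b: "\<beta> < b" "b < real N + 1" and good: "good b s"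
    and pat: "is_Pat (start b s) (neg_beta b) n \<pi>" and b': "b' \<in> base_set n \<pi>"
  shows "\<beta> \<le> b'"
proof (rule ccontr)
  assume less: "\<not> \<beta> \<le> b'"
  obtain x' where x': "b' > 1" "x' \<in> {0<..1}" "is_Pat x' (neg_beta b') n \<pi>"
    using b' by (rule base_setE)
  have b1: "b > 1" using b \<beta>(1) by simp
  have it: "iter b k (start b s) = Y b s k" if "k < n" for k
    using good_realization(2)[OF b1 good that] .
  have "N + 2 \<le> n" using N_less_i by (simp add: n_def K(1) Suc_le_eq less_Suc_eq)
    (use K(1) in linarith)
  have floors: "\<lfloor>b\<rfloor> \<le> int N" "\<lfloor>b'\<rfloor> \<le> int N"
    using b less \<beta> by linarith+
  have inc: "iter b k (start b s) < iter b (Suc k) (start b s)" if "k \<le> N" for k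
  proof -
    have "Y b s k < Y b s (Suc k)" using good that by (simp add: good_def)
    moreover have "iter b k (start b s) = Y b s k" "iter b (Suc k) (start b s) = Y b s (Suc k)"
      using \<open>N + 2 \<le> n\<close> that by (auto intro!: it simp del: funpow.simps)
    ultimately show ?thesis by simp
  qed
  have digits: "\<lfloor>b' * iter b' k x'\<rfloor> = d k" if "Suc k < n" for k
  proof -
    have "\<lfloor>b * iter b k (start b s)\<rfloor> = \<lfloor>b' * iter b' k x'\<rfloor>"
      using b1 floors good_realization(1)[OF b1 good] x' pat \<open>N + 2 \<le> n\<close> inc that
      by (intro is_Pat_digits_eq) (auto simp del: funpow.simps)
    moreover have "0 < Y b s (Suc k)" "Y b s (Suc k) \<le> 1"
      using good that by (auto simp: good_def intro: less_imp_le)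
    then have "\<lfloor>b * Y b s k\<rfloor> = d k" unfolding Y_def by (rule orb_digit)
    ultimately show ?thesis using it[of k] that by simp
  qed
  define y where "y k = iter b' k x'" for k
  have y_orb: "y k = orb d b' x' k" if "k < n" for k
  proof -
    have "y k = orb (\<lambda>j. \<lfloor>b' * iter b' j x'\<rfloor>) b' x' k" unfolding y_def by (rule iter_eq_orb)
    also have "\<dots> = orb d b' x' k" using that digits by (intro orb_cong) auto
    finally show ?thesis .
  qed
  have idx: "i + k < n" "h + k < n" if "k \<le> K" for k
    using that by (auto simp: n_def)
  have yi: "y (i + k) = orb a b' (y i) k" if "k \<le> K" for k
    using y_orb[OF idx(1)[OF that]] y_orb[of i] idx(1)[of 0] by (simp add: orb_add d_i)
  have yh: "y (h + k) = orb a b' (y h) k" if "k \<le> K" for k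
  proof -
    have "y (h + k) = orb (\<lambda>j. d (h + j)) b' (y h) k"
      using y_orb[OF idx(2)[OF that]] y_orb[of h] idx(2)[of 0] by (simp add: orb_add)
    also have "\<dots> = orb a b' (y h) k" using that by (intro orb_cong) (auto simp: d_h)
    finally show ?thesis .
  qed
  have iff: "Y b s j < Y b s k \<longleftrightarrow> y j < y k" if "j < n" "k < n" for j k
    using is_Pat_less_iff[OF pat that] is_Pat_less_iff[OF x'(3) that] it that by (simp add: y_def)
  define \<kappa> where "\<kappa> b = (- b) ^ K - (- b) ^ m" for b :: real
  have \<kappa>: "0 < \<kappa> b * \<kappa> b'"
    unfolding \<kappa>_def using pow_diff_same_sign[OF b1 x'(1), of m K] K(1) by simp
  \<comment> \<open>The side of \<open>\<zeta>\<close> on which the point at time \<open>l\<close>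
    lies is read off from the order of the points at \<open>l + K\<close> and \<open>l + m\<close>.
    The pattern fixes this order, and the factors \<open>\<kappa>\<close> have equal signs.\<close>
  have transfer: "(\<zeta> b < Y b s l \<longrightarrow> \<zeta> b' < y l) \<and> (Y b s l < \<zeta> b \<longrightarrow> y l < \<zeta> b')"
    if Yl: "\<And>k. k \<le> K \<Longrightarrow> Y b s (l + k) = orb a b (Y b s l) k"
      and yl: "\<And>k. k \<le> K \<Longrightarrow> y (l + k) = orb a b' (y l) k" and l: "l + K < n" for l
  proof -
    have m: "m \<le> K" using K(1) by simp
    have 1: "Y b s (l + K) - Y b s (l + m) = \<kappa> b * (Y b s l - \<zeta> b)"
      unfolding Yl[OF order_refl] Yl[OF m] \<kappa>_def \<zeta>_def by (rule orb_return_diff[OF b1 K(1)])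
    have 2: "y (l + K) - y (l + m) = \<kappa> b' * (y l - \<zeta> b')"
      unfolding yl[OF order_refl] yl[OF m] \<kappa>_def \<zeta>_def by (rule orb_return_diff[OF x'(1) K(1)])
    have less1: "0 < \<kappa> b * (Y b s l - \<zeta> b) \<longleftrightarrow> 0 < \<kappa> b' * (y l - \<zeta> b')"
      using iff[of "l + m" "l + K"] l m unfolding 1[symmetric] 2[symmetric] by simp
    have less2: "\<kappa> b * (Y b s l - \<zeta> b) < 0 \<longleftrightarrow> \<kappa> b' * (y l - \<zeta> b') < 0"
      using iff[of "l + K" "l + m"] l m unfolding 1[symmetric] 2[symmetric] by simp
    show ?thesis
      using less1 less2 \<kappa> by (auto simp: zero_less_mult_iff mult_less_0_iff)
  qed
  have "\<zeta> b' < y i"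
    using transfer[of i] good Y_add_i[of b s] b1 yi idx(1)[of K] Y_i[of b s] by (simp add: good_def)
  moreover have "y h < \<zeta> b'"
    using transfer[of h] good Y_add_h yh idx(2)[of K] by (simp add: good_def)
  ultimately have between: "y h < \<zeta> b'" "\<zeta> b' < y i" by auto
  \<comment> \<open>An affine map preserves betweenness, here expressed by a nonpositive product of
    differences.\<close>
  have z_between: "min (y (i + k)) (y (h + k)) \<le> z b' k \<and> z b' k \<le> max (y (i + k)) (y (h + k))"
    if "k \<le> K" for k
  proof -
    have "z b' k - y (i + k) = (- b') ^ k * (\<zeta> b' - y i)"
      unfolding yi[OF that] z_def by (rule orb_diff)
    moreover have "z b' k - y (h + k) = (- b') ^ k * (\<zeta> b' - y h)"
      unfolding yh[OF that] z_def by (rule orb_diff)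
    ultimately have "(z b' k - y (i + k)) * (z b' k - y (h + k)) =
        ((- b') ^ k)\<^sup>2 * ((\<zeta> b' - y i) * (\<zeta> b' - y h))"
      by (simp add: power2_eq_square)
    also have "\<dots> \<le> 0"
      using between by (intro mult_nonneg_nonpos zero_le_power2 mult_nonpos_nonneg) auto
    finally show ?thesis by (auto simp: mult_le_0_iff)
  qed
  have "\<beta> \<le> b'"
  proof (rule base_compare(1)[OF x'(1)])
    fix j k assume jk: "j < K" "k < K" "c j < c k"
    then have "Y b s (i + j) < Y b s (i + k) \<and> Y b s (i + j) < Y b s (h + k) \<and>
        Y b s (h + j) < Y b s (i + k) \<and> Y b s (h + j) < Y b s (h + k)"
      using good unfolding good_def by blast
    then have "max (y (i + j)) (y (h + j)) < min (y (i + k)) (y (h + k))"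
      using iff idx[of j] idx[of k] jk by simp
    moreover have "z b' j \<le> max (y (i + j)) (y (h + j))" "min (y (i + k)) (y (h + k)) \<le> z b' k"
      using z_between[of j] z_between[of k] jk by auto
    ultimately show "z b' j < z b' k" by linarith
  next
    fix k assume "k < K"
    moreover have "0 < y j" for j
      using iter_in_unit[OF x'(2), where b = b' and k = j] by (simp add: y_def)
    ultimately show "0 < z b' k" using z_between[of k] by (smt (verit) min_def less_imp_le)
  next
    show "\<zeta> b' \<le> 1"
      using between iter_in_unit[OF x'(2), where b = b' and k = i] by (simp add: y_def)
  qed
  then show False using less by simp
qed

text \<open>There are only finitely many patterns of length \<open>n\<close>. If every infimum that
  is at least \<open>\<beta>\<close> exceeded it, a gap above \<open>\<beta>\<close> would remain;
  but a good start in a base inside the gap realizes a pattern with infimum in the gap.\<close>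

lemma ex_B_minus: "\<exists>n \<pi>. n \<ge> 1 \<and> \<pi> permutes {1..n} \<and> B_minus n \<pi> = \<beta>"
proof (rule ccontr)
  assume no: "\<not> ?thesis"
  have n1: "n \<ge> 1" by (simp add: n_def)
  define G where "G = {\<pi>. \<pi> permutes {1..n} \<and> base_set n \<pi> \<noteq> {} \<and> (\<forall>b\<in>base_set n \<pi>. \<beta> \<le> b)}"
  \<comment> \<open>The entry \<open>real N + 1\<close> keeps the chosen base below the next
    integer, as required for the digits.\<close>
  define M where "M = Min (insert (real N + 1) (B_minus n ` G))"
  have "finite G"
    by (rule finite_subset[OF _ finite_permutations[of "{1..n}"]]) (auto simp: G_def)
  then have fin: "finite (insert (real N + 1) (B_minus n ` G))" by simp
  have "\<beta> < B_minus n \<pi>" if "\<pi> \<in> G" for \<pi>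
  proof -
    have "\<beta> \<le> B_minus n \<pi>"
      unfolding B_minus_eq using that by (intro cInf_greatest) (auto simp: G_def)
    moreover have "B_minus n \<pi> \<noteq> \<beta>" using no n1 that by (auto simp: G_def)
    ultimately show ?thesis by simp
  qed
  then have "\<beta> < M" unfolding M_def using fin \<beta>(3) by (subst Min_gr_iff) auto
  then have "\<forall>\<^sub>F b in at_right \<beta>. \<beta> < b \<and> b < M"
    using eventually_at_right_real[of \<beta> M] by simp
  from eventually_happens'[OF trivial_limit_at_right_real eventually_conj[OF this eventually_good]]
  obtain b where b: "\<beta> < b" "b < M" "\<forall>\<^sub>F s in at_right (\<zeta> b). good b s" by blast
  from eventually_happens'[OF trivial_limit_at_right_real b(3)] obtain s where s: "good b s" by blast
  have b1: "b > 1" using b(1) \<beta>(1) by simp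
  obtain \<pi> where \<pi>: "is_Pat (start b s) (neg_beta b) n \<pi>"
    using good_realization(3)[OF b1 s] by blast
  have "M \<le> real N + 1" unfolding M_def using fin by (intro Min_le) auto
  then have bN: "b < real N + 1" using b(2) by simp
  have mem: "b \<in> base_set n \<pi>"
    using base_setI[OF b1 n1 good_realization(1)[OF b1 s] \<pi>] .
  have "\<pi> \<in> G"
    using \<pi> mem good_lower_bound[OF b(1) bN s \<pi>] by (auto simp: G_def is_Pat_def)
  then have "M \<le> B_minus n \<pi>" unfolding M_def using fin by (intro Min_le) auto
  also have "\<dots> \<le> b" unfolding B_minus_eq by (rule cInf_lower[OF mem bdd_below_base_set])
  finally show False using b(2) by simp
qed

end

lemma Yrrap_imp_B_minus:
  assumes "Yrrap \<beta>"
  shows "\<exists>n \<pi>. n \<ge> 1 \<and> \<pi> permutes {1..n} \<and> B_minus n \<pi> = \<beta>"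
proof -
  have \<beta>: "\<beta> > 1" and "\<not> inj (\<lambda>k. iter \<beta> k 1)" using assms by (auto simp: Yrrap_iff)
  then obtain m K where K: "m < K" "iter \<beta> K 1 = iter \<beta> m 1" "inj_on (\<lambda>k. iter \<beta> k 1) {..<K}"
    using first_return[of "\<lambda>k. iter \<beta> k 1"] by blast
  define N where "N = nat \<lfloor>\<beta>\<rfloor>"
  have N: "1 \<le> N" "real N \<le> \<beta>" "\<beta> < real N + 1"
    using \<beta> unfolding N_def by linarith+
  show ?thesis
  proof (cases "real N = \<beta>")
    case True
    then have "2 \<le> N" using \<beta> by simp
    then show ?thesis
      using B_minus_identity[of N] True permutes_id[of "{1..N + 2}"]
      by (intro exI[of _ "N + 2"] exI[of _ id]) auto
  next
    case False
    then have N': "real N < \<beta>" using N by simp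
    obtain u v where uv: "0 < u" "u < v" "v < 1"
      "\<And>x. u < x \<Longrightarrow> x < v \<Longrightarrow> \<forall>k\<le>N. iter \<beta> k x < iter \<beta> (Suc k) x"
      using ex_increasing_prefix[OF N(1) N'] by blast
    define c where "c k = iter \<beta> k 1" for k
    have c_close: "\<exists>x h i. u < x \<and> x < v \<and> iter \<beta> i x = 1 \<and> (\<forall>k<i. iter \<beta> k x < 1) \<and>
      (\<forall>k<K. \<lfloor>\<beta> * iter \<beta> (h + k) x\<rfloor> = \<lfloor>\<beta> * c k\<rfloor> \<and> \<bar>iter \<beta> (h + k) x - c k\<bar> < e) \<and>
      (h < i \<or> m = 0 \<and> odd K \<and> h = i + K)" if e: "e > 0" for e
    proof (cases "m = 0 \<and> odd K")
      case True
      \<comment> \<open>The auxiliary \<open>h\<close> is discarded here: the visit at time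
        \<open>i + K\<close> repeats the orbit of 1 exactly.\<close>
      obtain x h i where x: "u < x" "x < v" "iter \<beta> i x = 1" "\<forall>k<i. iter \<beta> k x < 1"
        using ex_iter_near_1_then_1[OF \<beta> uv(1-3) zero_less_one] by blast
      have "iter \<beta> (i + K + k) x = c k" for k
      proof -
        have "iter \<beta> (i + K + k) x = iter \<beta> (K + k) 1"
          using iter_add[where b = \<beta> and i = i and k = "K + k" and x = x] x(3) by (simp only: add.assoc)
        also have "\<dots> = c k"
          using iter_add[where b = \<beta> and i = K and k = k and x = 1] K(2) True by (simp add: c_def)
        finally show ?thesis .
      qed
      then show ?thesis
        using x True that by (intro exI[of _ x] exI[of _ "i + K"] exI[of _ i]) auto
    next
      case False
      obtain \<epsilon> where \<epsilon>: "\<epsilon> > 0" "\<And>s k. 1 - \<epsilon> < s \<Longrightarrow> s < 1 \<Longrightarrow> k < K \<Longrightarrow>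
        \<bar>iter \<beta> k s - c k\<bar> < e \<and> \<lfloor>\<beta> * iter \<beta> k s\<rfloor> = \<lfloor>\<beta> * c k\<rfloor>"
        using orb_near_1[OF \<beta> K False e] unfolding c_def by blast
      obtain x h i where x: "u < x" "x < v" "h < i" "1 - \<epsilon> < iter \<beta> h x" "iter \<beta> h x < 1"
        "iter \<beta> i x = 1" "\<forall>k<i. iter \<beta> k x < 1"
        using ex_iter_near_1_then_1[OF \<beta> uv(1-3) \<epsilon>(1)] by blast
      have "\<bar>iter \<beta> (h + k) x - c k\<bar> < e \<and> \<lfloor>\<beta> * iter \<beta> (h + k) x\<rfloor> = \<lfloor>\<beta> * c k\<rfloor>" if "k < K" for k
        unfolding iter_add by (rule \<epsilon>(2)[OF x(4,5) that])
      then show ?thesis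
        using x by (intro exI[of _ x] exI[of _ h] exI[of _ i]) auto
    qed
    define D where "D = insert 1 ((\<lambda>(j, k). c k - c j) ` {(j, k). j < K \<and> k < K \<and> c j < c k})"
    have "{(j, k). j < K \<and> k < K \<and> c j < c k} \<subseteq> {..<K} \<times> {..<K}" by auto
    then have "finite D" unfolding D_def
      by (meson finite.insertI finite_SigmaI finite_imageI finite_lessThan finite_subset)
    \<comment> \<open>Half the smallest gap: two points each displaced by less than \<open>e\<close>
      keep their order. The entry 1 in \<open>D\<close> covers the absence of gaps.\<close>
    define e where "e = Min D / 2"
    have "0 < Min D" using \<open>finite D\<close> by (subst Min_gr_iff) (auto simp: D_def)
    then have "e > 0" by (simp add: e_def)
    have gap: "2 * e \<le> c k - c j" if "j < K" "k < K" "c j < c k" for j k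
    proof -
      have "c k - c j \<in> D" unfolding D_def using that by force
      then have "Min D \<le> c k - c j" using \<open>finite D\<close> by (intro Min_le)
      then show ?thesis by (simp add: e_def)
    qed
    obtain x h i where x: "u < x" "x < v" "iter \<beta> i x = 1" "\<And>k. k < i \<Longrightarrow> iter \<beta> k x < 1"
      "\<And>k. k < K \<Longrightarrow> \<lfloor>\<beta> * iter \<beta> (h + k) x\<rfloor> = \<lfloor>\<beta> * c k\<rfloor>"
      "\<And>k. k < K \<Longrightarrow> \<bar>iter \<beta> (h + k) x - c k\<bar> < e"
      "h < i \<or> m = 0 \<and> odd K \<and> h = i + K"
      using c_close[OF \<open>e > 0\<close>] by blast
    interpret yrrap_orbit \<beta> x N m K i h
    proof
      show "\<beta> > 1" "real N < \<beta>" "\<beta> < real N + 1" using \<beta> N N' by auto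
      show "m < K" "iter \<beta> K 1 = iter \<beta> m 1" "inj_on (\<lambda>k. iter \<beta> k 1) {..<K}" using K by auto
      show "x \<in> {0<..1}" using x uv by simp
      show "iter \<beta> k x < iter \<beta> (Suc k) x" if "k \<le> N" for k using uv(4)[OF x(1,2)] that by blast
      show "iter \<beta> i x = 1" by (rule x)
      show "iter \<beta> k x < 1" if "k < i" for k using that by (rule x)
      show "\<lfloor>\<beta> * iter \<beta> (h + k) x\<rfloor> = \<lfloor>\<beta> * iter \<beta> k 1\<rfloor>" if "k < K" for k
        using x(5)[OF that] by (simp only: c_def)
      show "iter \<beta> (h + j) x < iter \<beta> k 1 \<and> iter \<beta> j 1 < iter \<beta> (h + k) x \<and> iter \<beta> (h + j) x < iter \<beta> (h + k) x"
        if "j < K" "k < K" "iter \<beta> j 1 < iter \<beta> k 1" for j k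
        using gap[OF that(1,2)] x(6)[OF that(1)] x(6)[OF that(2)] that(3) \<open>e > 0\<close>
        unfolding c_def by linarith
      show "h < i \<or> m = 0 \<and> odd K \<and> h = i + K" by (rule x)
    qed
    show ?thesis by (rule ex_B_minus)
  qed
qed

theorem theorem4:
  fixes \<beta> :: real
  assumes "\<beta> > 1"
  shows "(\<exists>n \<pi>. n \<ge> 1 \<and> \<pi> permutes {1..n} \<and> B_minus n \<pi> = \<beta>) \<longleftrightarrow> Yrrap \<beta>"
  using B_minus_imp_Yrrap Yrrap_imp_B_minus assms by blast

end
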